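(* Every instance of fair allocation of goods with additive valuations having $n \neq 3$ agents and $m \le n + 6$ goods admits an MMS allocation.
   Context: An instance of fair allocation of goods consists of a set $N=\{1,\dots,n\}$ of agents, a set $M=\{1,\dots,m\}$ of goods, and for each agent $i$ an additive valuation $v_i:2^M\to\mathbb{R}$ with $v_i(\emptyset)=0$, $v_i(S)=\sum_{g\in S}v_i(\{g\})$ and $v_i(\{g\})\ge 0$. An allocation is an ordered $n$-tuple $\langle A_1,\dots,A_n\rangle$ of pairwise disjoint (possibly empty) subsets of $M$ with union $M$. The maximin share of agent $i$ is $\mu_i=\max_{A}\min_{j} v_i(A_j)$ over all allocations $A$. An MMS allocation is an allocation with $v_i(A_i)\ge\mu_i$ for all $i$. *)

theory Defs
  imports Complex_Main
begin

(* Agents are 0..<n, goods are 0..<m. An additive valuation of agent i is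
   given by its values v i g on single goods; v_i(S) = sum over g in S. *)

definition bundle_value :: "(nat \<Rightarrow> nat \<Rightarrow> real) \<Rightarrow> nat \<Rightarrow> nat set \<Rightarrow> real" where
  "bundle_value v i S = (\<Sum>g\<in>S. v i g)"

(* An allocation of goods {0..<m} to agents {0..<n}: an n-tuple of pairwise
   disjoint bundles whose union is all goods (represented as a function that
   is {} outside the agent set, so that allocations correspond one-to-one to
   n-tuples). *)
definition is_allocation :: "nat \<Rightarrow> nat \<Rightarrow> (nat \<Rightarrow> nat set) \<Rightarrow> bool" where
  "is_allocation n m A \<longleftrightarrow>
     (\<forall>j. j \<ge> n \<longrightarrow> A j = {}) \<and>
     (\<forall>j<n. \<forall>k<n. j \<noteq> k \<longrightarrow> A j \<inter> A k = {}) \<and>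
     (\<Union>j<n. A j) = {0..<m}"

definition mms :: "nat \<Rightarrow> nat \<Rightarrow> (nat \<Rightarrow> nat \<Rightarrow> real) \<Rightarrow> nat \<Rightarrow> real" where
  "mms n m v i = Max {Min {bundle_value v i (A j) | j. j < n} | A. is_allocation n m A}"

definition is_MMS_allocation :: "nat \<Rightarrow> nat \<Rightarrow> (nat \<Rightarrow> nat \<Rightarrow> real) \<Rightarrow> (nat \<Rightarrow> nat set) \<Rightarrow> bool" where
  "is_MMS_allocation n m v A \<longleftrightarrow>
     is_allocation n m A \<and> (\<forall>i<n. bundle_value v i (A i) \<ge> mms n m v i)"

end

(* If agent j values W at most at her threshold and W meets at most two of her bundles, then merging
   those two bundles and discarding W leaves her a split into one bundle fewer.  Hence, whenever three
   agents cannot be served, each agent's three bundles are X, Y, Z where the other two agents want X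
   only, and Y and Z meet every bundle of the other agents.  So Y and Z have at least three goods, and
   an X with at most two goods is disjoint from the X of every other agent; two such small X would
   yield an allocation.  This settles three agents and eight goods.

   Let four agents share ten goods and let some agent accept a single good g.  Then, for each agent
   accepting g, the other three cannot be served from the nine remaining goods.  At most one of the
   four has a small X, and the other three hold pairwise orthogonal partitions into triples, i.e. the
   rows, columns and broken diagonals of a 3x3 grid, which contradicts the valuation of one of them.

   If n >= 4 and no agent accepts a single good, order the goods by value.  Every agent has at least
   2n - 6 bundles of two goods, each containing one of the n - 1 best goods (otherwise the n-th and
   the (n+1)-st good can be given away together), so by double counting some good k < n - 1 lies in a
   pair of all agents but at most one.  Giving away k with the worst of its partners reduces the
   instance to n - 1 agents and two goods fewer. *)
theory Submission
  imports Defs "HOL-Library.Disjoint_Sets"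
begin

subsection \<open>Splitting and reduction\<close>

text \<open>The bundles need not cover \<open>S\<close>, and the index set is arbitrary: a bundle can be
  dropped without renumbering the others.\<close>

definition splits :: "('g \<Rightarrow> real) \<Rightarrow> real \<Rightarrow> nat \<Rightarrow> 'g set \<Rightarrow> bool" where
  "splits f c k S \<longleftrightarrow> (\<exists>(I::nat set) A. finite I \<and> card I = k \<and> disjoint_family_on A I \<and>
     (\<forall>j\<in>I. A j \<subseteq> S \<and> c \<le> sum f (A j)))"

definition allocatable :: "('a \<Rightarrow> 'g \<Rightarrow> real) \<Rightarrow> ('a \<Rightarrow> real) \<Rightarrow> 'a set \<Rightarrow> 'g set \<Rightarrow> bool" where
  "allocatable v t N S \<longleftrightarrow> (\<exists>A. disjoint_family_on A N \<and>
     (\<forall>i\<in>N. A i \<subseteq> S \<and> t i \<le> sum (v i) (A i)))"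

lemma splitsI:
  assumes "finite I" "disjoint_family_on A (I::nat set)"
    and "\<And>j. j \<in> I \<Longrightarrow> A j \<subseteq> S" "\<And>j. j \<in> I \<Longrightarrow> c \<le> sum f (A j)"
  shows "splits f c (card I) S"
  using assms unfolding splits_def by blast

lemma splitsE:
  assumes "splits f c k S"
  obtains I :: "nat set" and A where "finite I" "card I = k" "disjoint_family_on A I"
    "\<forall>j\<in>I. A j \<subseteq> S" "\<forall>j\<in>I. c \<le> sum f (A j)"
  using assms unfolding splits_def by blast

locale valuations =
  fixes v :: "'a \<Rightarrow> 'g \<Rightarrow> real" and t :: "'a \<Rightarrow> real"
  assumes nonneg: "0 \<le> v i g"
begin

abbreviation likes :: "'a \<Rightarrow> 'g set \<Rightarrow> bool" where
  "likes i S \<equiv> t i \<le> sum (v i) S"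

lemma likes_mono: "likes i A \<Longrightarrow> A \<subseteq> B \<Longrightarrow> finite B \<Longrightarrow> likes i B"
  using sum_mono2[of B A "v i"] nonneg by force

lemma splits_total:
  assumes "splits (v i) c k S" "finite S"
  shows "real k * c \<le> sum (v i) S"
proof -
  obtain I :: "nat set" and A where I: "finite I" "card I = k" "disjoint_family_on A I"
    "\<forall>j\<in>I. A j \<subseteq> S" "\<forall>j\<in>I. c \<le> sum (v i) (A j)"
    by (rule splitsE[OF assms(1)])
  have "real k * c \<le> (\<Sum>j\<in>I. sum (v i) (A j))"
    using sum_mono[of I "\<lambda>_. c" "\<lambda>j. sum (v i) (A j)"] I by simp
  also have "\<dots> = sum (v i) (\<Union>j\<in>I. A j)"
    using I assms(2) by (intro sum.UNION_disjoint[symmetric])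
      (auto simp: disjoint_family_on_def dest: finite_subset)
  also have "\<dots> \<le> sum (v i) S"
    using I assms(2) nonneg by (intro sum_mono2) auto
  finally show ?thesis .
qed

text \<open>Leftover goods are poured into one existing bundle, which loses nothing because values
  are nonnegative. Hence a split may be taken to cover \<open>S\<close>.\<close>

lemma splits_full:
  assumes "splits (v i) c k S" "finite S" "0 < k"
  obtains I :: "nat set" and A where "finite I" "card I = k" "disjoint_family_on A I"
    "(\<Union>j\<in>I. A j) = S" "\<forall>j\<in>I. c \<le> sum (v i) (A j)"
proof -
  obtain I :: "nat set" and A where I: "finite I" "card I = k" "disjoint_family_on A I"
    "\<forall>j\<in>I. A j \<subseteq> S" "\<forall>j\<in>I. c \<le> sum (v i) (A j)"
    by (rule splitsE[OF assms(1)])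
  then obtain a where a: "a \<in> I" using assms(3) by fastforce
  define B where "B = A(a := A a \<union> (S - (\<Union>j\<in>I. A j)))"
  have "sum (v i) (A a) \<le> sum (v i) (B a)"
    using I(4) a assms(2) nonneg unfolding B_def by (intro sum_mono2) (auto intro: finite_subset)
  with I(5) a have "c \<le> sum (v i) (B a)" by force
  then show ?thesis
    using I a by (intro that[of I B]) (auto simp: disjoint_family_on_def B_def split: if_splits)
qed

lemma splits_remove:
  fixes I :: "nat set"
  assumes I: "finite I" "disjoint_family_on A I" "\<And>j. j \<in> I \<Longrightarrow> A j \<subseteq> S" "\<And>j. j \<in> I \<Longrightarrow> c \<le> sum (v i) (A j)"
    and "a \<in> I" and W: "\<And>j. j \<in> I \<Longrightarrow> j \<noteq> a \<Longrightarrow> A j \<inter> W = {}"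
  shows "splits (v i) c (card I - 1) (S - W)"
proof -
  have "splits (v i) c (card (I - {a})) (S - W)"
    using I W by (intro splitsI[where A=A]) (auto simp: disjoint_family_on_def, blast)
  then show ?thesis using I assms(5) by simp
qed

text \<open>Together the bundles \<open>a\<close> and \<open>b\<close> are worth at least
  \<open>2 * c\<close>, and \<open>W\<close> takes away at most \<open>c\<close>. What remains of
  their union is one good bundle, so removing \<open>W\<close> costs a single bundle although it may
  touch two.\<close>

lemma splits_merge:
  fixes I :: "nat set"
  assumes I: "finite I" "disjoint_family_on A I" "\<And>j. j \<in> I \<Longrightarrow> A j \<subseteq> S" "\<And>j. j \<in> I \<Longrightarrow> c \<le> sum (v i) (A j)"
    and "finite S" "a \<in> I" "b \<in> I" "a \<noteq> b" and W: "\<And>j. j \<in> I \<Longrightarrow> j \<noteq> a \<Longrightarrow> j \<noteq> b \<Longrightarrow> A j \<inter> W = {}"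
    and "sum (v i) W \<le> c" "finite W"
  shows "splits (v i) c (card I - 1) (S - W)"
proof -
  define B where "B = A(a := (A a \<union> A b) - W)"
  have fin: "finite (A a)" "finite (A b)" using I assms by (auto intro: finite_subset)
  have ab: "A a \<inter> A b = {}" using assms by (auto simp: disjoint_family_on_def)
  have "2 * c \<le> sum (v i) (A a \<union> A b)"
    using I(4)[OF \<open>a \<in> I\<close>] I(4)[OF \<open>b \<in> I\<close>] fin ab by (simp add: sum.union_disjoint)
  also have "\<dots> = sum (v i) (B a) + sum (v i) ((A a \<union> A b) \<inter> W)"
    unfolding B_def using fin by (simp add: sum.Int_Diff[of "A a \<union> A b" _ W] add.commute)
  also have "sum (v i) ((A a \<union> A b) \<inter> W) \<le> sum (v i) W"
    using assms nonneg by (intro sum_mono2) auto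
  finally have "c \<le> sum (v i) (B a)" using assms by linarith
  moreover have "B j = A j" if "j \<noteq> a" for j using that by (simp add: B_def)
  moreover have "B a \<subseteq> S - W" using I assms by (auto simp: B_def)
  moreover have "disjoint_family_on B (I - {b})"
    using I assms by (auto simp: disjoint_family_on_def B_def split: if_splits)
  ultimately have "splits (v i) c (card (I - {b})) (S - W)"
    using I W by (intro splitsI[where A=B]) (auto, (metis DiffD2 DiffE disjoint_iff subsetD)+)
  then show ?thesis using I assms by simp
qed

lemma splits_remove_good:
  assumes "splits (v i) c (Suc k) S" "finite S"
  shows "splits (v i) c k (S - {g})"
proof -
  obtain I :: "nat set" and A where I: "finite I" "card I = Suc k" "disjoint_family_on A I"
    "(\<Union>j\<in>I. A j) = S" "\<forall>j\<in>I. c \<le> sum (v i) (A j)"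
    using splits_full[OF assms] by (metis zero_less_Suc pos2)
  then obtain a where a: "a \<in> I" by fastforce
  obtain b where b: "b \<in> I" "\<And>j. j \<in> I \<Longrightarrow> j \<noteq> b \<Longrightarrow> A j \<inter> {g} = {}"
  proof (cases "\<exists>b\<in>I. g \<in> A b")
    case True
    then obtain b where "b \<in> I" "g \<in> A b" by auto
    then show ?thesis using I(3) by (intro that[of b]) (auto simp: disjoint_family_on_def)
  qed (use a that in auto)
  show ?thesis using splits_remove[of I A S c i b "{g}"] I b by auto
qed

text \<open>If \<open>x\<close> and \<open>y\<close> share a bundle, that bundle is dropped;
  otherwise their two bundles are merged. Either way one bundle is lost.\<close>

lemma splits_remove_pair:
  assumes "splits (v i) c (Suc k) S" "finite S" "sum (v i) {x, y} \<le> c"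
  shows "splits (v i) c k (S - {x, y})"
proof -
  obtain I :: "nat set" and A where I: "finite I" "card I = Suc k" "disjoint_family_on A I"
    "(\<Union>j\<in>I. A j) = S" "\<forall>j\<in>I. c \<le> sum (v i) (A j)"
    using splits_full[OF assms(1,2)] by (metis zero_less_Suc pos2)
  then obtain a where a: "a \<in> I" by fastforce
  have ex: "\<exists>b\<in>I. \<forall>j\<in>I. j \<noteq> b \<longrightarrow> g \<notin> A j" for g
  proof (cases "\<exists>b\<in>I. g \<in> A b")
    case True
    then obtain b where "b \<in> I" "g \<in> A b" by auto
    then show ?thesis using I(3) by (intro bexI[of _ b]) (auto simp: disjoint_family_on_def)
  qed (use a in auto)
  obtain p where p: "p \<in> I" "\<And>j. j \<in> I \<Longrightarrow> j \<noteq> p \<Longrightarrow> x \<notin> A j" using ex[of x] by auto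
  obtain q where q: "q \<in> I" "\<And>j. j \<in> I \<Longrightarrow> j \<noteq> q \<Longrightarrow> y \<notin> A j" using ex[of y] by auto
  show ?thesis
  proof (cases "p = q")
    case True
    then show ?thesis using splits_remove[of I A S c i p "{x, y}"] I p q by auto
  next
    case False
    then show ?thesis using splits_merge[of I A S c i p q "{x, y}"] I p q assms by auto
  qed
qed

lemma allocatable_reduce:
  assumes "allocatable v t (N - {i}) (S - B)" "B \<subseteq> S" "likes i B"
  shows "allocatable v t N S"
proof -
  obtain A where A: "disjoint_family_on A (N - {i})"
    "\<And>j. j \<in> N - {i} \<Longrightarrow> A j \<subseteq> S - B \<and> likes j (A j)"
    using assms(1) unfolding allocatable_def by blast
  have "disjoint_family_on (A(i := B)) N"
    using A unfolding disjoint_family_on_def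
    by (auto split: if_splits)
  moreover have "\<forall>j\<in>N. (A(i := B)) j \<subseteq> S \<and> likes j ((A(i := B)) j)"
    using A assms by auto
  ultimately show ?thesis unfolding allocatable_def by blast
qed

lemma allocatable_single:
  assumes "likes i S"
  shows "allocatable v t {i} S"
  using assms unfolding allocatable_def by (intro exI[of _ "\<lambda>_. S"]) (auto simp: disjoint_family_on_def)

text \<open>Cut and choose: \<open>i\<close> cuts \<open>S\<close> into two acceptable halves, and
  \<open>j\<close> accepts the half that is worth more to her.\<close>

lemma allocatable_two:
  assumes "finite S" "i \<noteq> j" "splits (v i) (t i) 2 S" "2 * t j \<le> sum (v j) S"
  shows "allocatable v t {i, j} S"
proof -
  obtain I :: "nat set" and A where I: "finite I" "card I = 2" "disjoint_family_on A I"
    "(\<Union>j\<in>I. A j) = S" "\<forall>j\<in>I. likes i (A j)"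
    using splits_full[OF assms(3,1)] by (metis zero_less_Suc pos2)
  obtain a b where ab: "I = {a, b}" "a \<noteq> b" using I by (auto simp: card_2_iff)
  have *: "allocatable v t {i, j} S" if "{a', b'} = I" "likes j (A a')" "a' \<noteq> b'" for a' b'
  proof (rule allocatable_reduce[where i=j and B="A a'"])
    have "A b' \<subseteq> S - A a'" using that I by (auto simp: disjoint_family_on_def)
    then have "likes i (S - A a')"
      using likes_mono[of i "A b'" "S - A a'"] I(5) that assms(1) by auto
    moreover have "{i, j} - {j} = {i}" using assms by auto
    ultimately show "allocatable v t ({i, j} - {j}) (S - A a')" using allocatable_single by simp
  qed (use that I in auto)
  have "sum (v j) S = sum (v j) (A a) + sum (v j) (A b)"
    using I ab assms(1) by (subst I(4)[symmetric]) (auto simp: disjoint_family_on_def intro!: sum.union_disjoint)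
  then have "likes j (A a) \<or> likes j (A b)" using assms(4) by linarith
  then show ?thesis using *[of a b] *[of b a] ab by auto
qed

subsection \<open>Three agents\<close>

definition part3 :: "'a \<Rightarrow> 'g set \<Rightarrow> 'g set \<Rightarrow> 'g set \<Rightarrow> 'g set \<Rightarrow> bool" where
  "part3 i S X Y Z \<longleftrightarrow> X \<union> Y \<union> Z = S \<and> X \<inter> Y = {} \<and> X \<inter> Z = {} \<and> Y \<inter> Z = {} \<and>
     likes i X \<and> likes i Y \<and> likes i Z"

definition favours :: "'a \<Rightarrow> 'g set \<Rightarrow> 'g set \<Rightarrow> 'g set \<Rightarrow> bool" where
  "favours j X Y Z \<longleftrightarrow> likes j X \<and> \<not> likes j Y \<and> \<not> likes j Z"

text \<open>The shape of a counterexample with three agents and any number of goods; the lemmas that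
  follow collect what it must look like.\<close>

definition stuck :: "'g set \<Rightarrow> 'a \<Rightarrow> 'a \<Rightarrow> 'a \<Rightarrow> bool" where
  "stuck S i j k \<longleftrightarrow> finite S \<and> i \<noteq> j \<and> i \<noteq> k \<and> j \<noteq> k \<and> (\<forall>l\<in>{i, j, k}. splits (v l) (t l) 3 S) \<and>
     \<not> allocatable v t {i, j, k} S"

lemma stuck_perm:
  assumes "stuck S i j k"
  shows "stuck S i k j" "stuck S j i k" "stuck S j k i" "stuck S k i j" "stuck S k j i"
  using assms unfolding stuck_def by (auto simp: insert_commute)

lemma splits_twoI:
  assumes "U \<union> V \<subseteq> S" "U \<inter> V = {}" "likes i U" "likes i V"
  shows "splits (v i) (t i) 2 S"
proof -
  have "splits (v i) (t i) (card {0, 1::nat}) S"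
    using assms by (intro splitsI[where A="\<lambda>n. if n = 0 then U else V"])
      (auto simp: disjoint_family_on_def)
  then show ?thesis by (simp add: numeral_2_eq_2)
qed

lemma splits_part3:
  assumes "splits (v i) (t i) 3 S" "finite S"
  obtains X Y Z where "part3 i S X Y Z"
proof -
  obtain I :: "nat set" and A where I: "finite I" "card I = 3" "disjoint_family_on A I"
    "(\<Union>j\<in>I. A j) = S" "\<forall>j\<in>I. likes i (A j)"
    using splits_full[OF assms] by (metis zero_less_numeral)
  then obtain a b c where "I = {a, b, c}" "a \<noteq> b" "a \<noteq> c" "b \<noteq> c" by (auto simp: card_3_iff)
  then show ?thesis
    using I by (intro that[of "A a" "A b" "A c"]) (auto simp: part3_def disjoint_family_on_def)
qed

lemma part3_sum:
  assumes "part3 i S X Y Z" "finite S"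
  shows "sum (v j) S = sum (v j) X + sum (v j) Y + sum (v j) Z"
proof -
  have "finite (X \<union> Y)" "finite Z" and S: "S = (X \<union> Y) \<union> Z" "(X \<union> Y) \<inter> Z = {}" "X \<inter> Y = {}"
    using assms by (auto simp: part3_def)
  then show ?thesis by (simp add: sum.union_disjoint)
qed

lemma allocatable_three:
  assumes "A \<subseteq> S" "B \<subseteq> S" "C \<subseteq> S" "A \<inter> B = {}" "A \<inter> C = {}" "B \<inter> C = {}"
    and "likes i A" "likes j B" "likes k C" "i \<noteq> j" "i \<noteq> k" "j \<noteq> k"
  shows "allocatable v t {i, j, k} S"
  unfolding allocatable_def
  using assms by (intro exI[of _ "\<lambda>l. if l = i then A else if l = j then B else C"])
    (auto simp: disjoint_family_on_def)

text \<open>By averaging, \<open>j\<close> and \<open>k\<close> each accept some bundle of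
  \<open>i\<close>. If they accepted different ones, \<open>i\<close> could take the third and
  everybody would be served. So they accept one and the same bundle and no other.\<close>

lemma stuck_favours:
  assumes "stuck S i j k" and P: "part3 i S A B C"
  shows "favours j A B C \<and> favours k A B C \<or> favours j B A C \<and> favours k B A C \<or>
    favours j C A B \<and> favours k C A B"
proof -
  have no: "\<not> (likes j Q \<and> likes k R)" if "part3 i S W Q R" for W Q R
    using assms(1) that allocatable_three[of W S Q R i j k] by (auto simp: stuck_def part3_def)
  have perm: "part3 i S A C B" "part3 i S B A C" "part3 i S B C A" "part3 i S C A B" "part3 i S C B A"
    using P by (auto simp: part3_def)
  have "likes l A \<or> likes l B \<or> likes l C" if "l \<in> {j, k}" for l
    using splits_total[of l "t l" 3 S] part3_sum[OF P, of l] that assms(1)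
    by (force simp: stuck_def)
  then have "likes j A \<or> likes j B \<or> likes j C" "likes k A \<or> likes k B \<or> likes k C" by auto
  then show ?thesis unfolding favours_def using no[OF P] perm[THEN no] by blast
qed

text \<open>Let \<open>i\<close> leave with \<open>W\<close>. Since \<open>k\<close> rejects
  \<open>W\<close>, at least \<open>2 * t k\<close> remains for her; if \<open>j\<close> could halve
  the remainder, \<open>j\<close> would cut and \<open>k\<close> would choose.\<close>

lemma stuck_not_split:
  assumes "stuck S i j k" "likes i W" "\<not> likes k W" "W \<subseteq> S" "U \<union> V \<subseteq> S - W" "U \<inter> V = {}" "likes j U"
  shows "\<not> likes j V"
proof
  assume "likes j V"
  then have *: "splits (v j) (t j) 2 (S - W)"
    using splits_twoI[of U V "S - W" j] assms by auto
  have "sum (v k) (S - W) = sum (v k) S - sum (v k) W"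
    using assms by (intro sum_diff) (auto simp: stuck_def)
  moreover have "3 * t k \<le> sum (v k) S"
    using splits_total[of k "t k" 3 S] assms by (auto simp: stuck_def)
  ultimately have "2 * t k \<le> sum (v k) (S - W)" using assms by linarith
  then have "allocatable v t {j, k} (S - W)"
    using * assms by (intro allocatable_two) (auto simp: stuck_def)
  moreover have "{j, k} = {i, j, k} - {i}" using assms by (auto simp: stuck_def)
  ultimately have "allocatable v t {i, j, k} S"
    using allocatable_reduce[of "{i, j, k}" i S W] assms by auto
  then show False using assms by (auto simp: stuck_def)
qed

text \<open>If \<open>A\<close> missed \<open>W\<close>, then \<open>W\<close> would lie in
  \<open>B \<union> C\<close>, which is worth \<open>2 * t j\<close> and loses less than
  \<open>t j\<close>. Then \<open>A\<close> and the rest of \<open>B \<union> C\<close> would halve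
  \<open>S - W\<close> for \<open>j\<close>, against \<open>stuck_not_split\<close>.\<close>

lemma stuck_meets:
  assumes "stuck S i j k" "likes i W" "\<not> likes j W" "\<not> likes k W" "W \<subseteq> S" and P: "part3 j S A B C"
  shows "A \<inter> W \<noteq> {}" "B \<inter> W \<noteq> {}" "C \<inter> W \<noteq> {}"
proof -
  have *: "A \<inter> W \<noteq> {}" if P: "part3 j S A B C" for A B C
  proof
    assume A: "A \<inter> W = {}"
    have fin: "finite S" using assms by (auto simp: stuck_def)
    have W: "W \<subseteq> B \<union> C" using A P assms by (auto simp: part3_def)
    have "finite (B \<union> C)" using P fin by (auto simp: part3_def)
    with W have "sum (v j) ((B \<union> C) - W) = sum (v j) (B \<union> C) - sum (v j) W"
      by (intro sum_diff) auto
    also have "sum (v j) (B \<union> C) = sum (v j) B + sum (v j) C"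
      using P fin by (intro sum.union_disjoint) (auto simp: part3_def)
    finally have "likes j ((B \<union> C) - W)" using P assms by (auto simp: part3_def)
    moreover have "likes j A" "A \<union> ((B \<union> C) - W) \<subseteq> S - W" "A \<inter> ((B \<union> C) - W) = {}"
      using P A by (auto simp: part3_def)
    ultimately show False using stuck_not_split[of S i j k W A] assms by blast
  qed
  have "part3 j S B A C" "part3 j S C A B" using P by (auto simp: part3_def)
  then show "A \<inter> W \<noteq> {}" "B \<inter> W \<noteq> {}" "C \<inter> W \<noteq> {}" using * P by blast+
qed

definition lab :: "'g set \<Rightarrow> 'a \<Rightarrow> 'a \<Rightarrow> 'a \<Rightarrow> 'g set \<Rightarrow> 'g set \<Rightarrow> 'g set \<Rightarrow> bool" where
  "lab S i j k X Y Z \<longleftrightarrow> part3 i S X Y Z \<and> favours j X Y Z \<and> favours k X Y Z"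

lemma lab_swap: "lab S i j k X Y Z \<longleftrightarrow> lab S i k j X Y Z"
  by (auto simp: lab_def)

lemma stuck_lab:
  assumes "stuck S i j k"
  obtains X Y Z where "lab S i j k X Y Z"
proof -
  obtain A B C where P: "part3 i S A B C"
    using assms splits_part3[of i S] by (auto simp: stuck_def)
  moreover from P have "part3 i S B A C" "part3 i S C A B" by (auto simp: part3_def)
  ultimately show ?thesis using stuck_favours[OF assms P] that by (auto simp: lab_def)
qed

text \<open>\<open>Y\<close> and \<open>Z\<close> are acceptable to \<open>i\<close> alone, so
  \<open>stuck_meets\<close> applies to both.\<close>

lemma lab_meets:
  assumes "stuck S i j k" "lab S i j k X Y Z" "part3 j S A B C" "W \<in> {Y, Z}"
  shows "A \<inter> W \<noteq> {}" "B \<inter> W \<noteq> {}" "C \<inter> W \<noteq> {}"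
  using stuck_meets[OF assms(1) _ _ _ _ assms(3), of W] assms
  by (auto simp: lab_def part3_def favours_def)

lemma card_ge_3I:
  assumes "A \<inter> W \<noteq> {}" "B \<inter> W \<noteq> {}" "C \<inter> W \<noteq> {}" "A \<inter> B = {}" "A \<inter> C = {}" "B \<inter> C = {}" "finite W"
  shows "3 \<le> card W"
proof -
  obtain a b c where "a \<in> A \<inter> W" "b \<in> B \<inter> W" "c \<in> C \<inter> W" using assms by blast
  moreover from this have "a \<noteq> b" "a \<noteq> c" "b \<noteq> c" using assms by blast+
  ultimately have "card {a, b, c} = 3" "{a, b, c} \<subseteq> W" by auto
  then show ?thesis using card_mono[OF assms(7)] by metis
qed

lemma lab_card:
  assumes "stuck S i j k" "lab S i j k X Y Z"
  shows "3 \<le> card Y" "3 \<le> card Z"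
proof -
  obtain A B C where P: "part3 j S A B C"
    using assms splits_part3[of j S] by (auto simp: stuck_def)
  have fin: "finite Y" "finite Z" using assms by (auto simp: stuck_def lab_def part3_def)
  show "3 \<le> card Y" using lab_meets[OF assms P, of Y] P fin
    by (intro card_ge_3I[of A _ B C]) (auto simp: part3_def)
  show "3 \<le> card Z" using lab_meets[OF assms P, of Z] P fin
    by (intro card_ge_3I[of A _ B C]) (auto simp: part3_def)
qed

lemma part3_card:
  assumes "part3 i S X Y Z" "finite S"
  shows "card S = card X + card Y + card Z"
proof -
  have "finite (X \<union> Y)" "finite Z" and S: "S = (X \<union> Y) \<union> Z" "(X \<union> Y) \<inter> Z = {}" "X \<inter> Y = {}"
    using assms by (auto simp: part3_def)
  then show ?thesis by (simp add: card_Un_disjoint)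
qed

text \<open>\<open>X\<close> is one of the bundles of \<open>i\<close>, so it meets
  \<open>Y'\<close> and \<open>Z'\<close>. Meeting \<open>X'\<close> as well would require a third
  good.\<close>

lemma lab_small_disjoint:
  assumes st: "stuck S i j k" and X: "lab S i j k X Y Z" and X': "lab S j i k X' Y' Z'" and "card X \<le> 2"
  shows "X \<inter> X' = {}"
proof (rule ccontr)
  assume "X \<inter> X' \<noteq> {}"
  moreover have "X \<inter> Y' \<noteq> {}" "X \<inter> Z' \<noteq> {}"
    using lab_meets[OF stuck_perm(2)[OF st] X', of X Y Z] X by (auto simp: lab_def)
  ultimately have "3 \<le> card X"
    using st X X' by (intro card_ge_3I[of X' _ Y' Z']) (auto simp: lab_def part3_def stuck_def)
  then show False using assms by simp
qed

text \<open>Among the contested bundles of the three agents, every two include a small one and are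
  therefore disjoint. Each agent then simply receives her own contested bundle.\<close>

lemma stuck_small_unique:
  assumes st: "stuck S i j k" and "lab S i j k X Y Z" "lab S j i k X' Y' Z'"
    and "card X \<le> 2" "card X' \<le> 2"
  shows False
proof -
  obtain X'' Y'' Z'' where k: "lab S k i j X'' Y'' Z''"
    using stuck_lab stuck_perm[OF st] by metis
  have "X \<inter> X' = {}" using lab_small_disjoint assms by metis
  moreover have "X \<inter> X'' = {}"
    using lab_small_disjoint[of S i k j X Y Z X''] assms k stuck_perm[OF st] lab_swap by metis
  moreover have "X' \<inter> X'' = {}"
    using lab_small_disjoint[of S j k i X' Y' Z' X''] assms k stuck_perm[OF st] lab_swap by metis
  ultimately have "allocatable v t {i, j, k} S"
    using assms k by (intro allocatable_three[of X _ X' X'']) (auto simp: lab_def part3_def stuck_def)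
  then show False using st by (auto simp: stuck_def)
qed

text \<open>The two uncontested bundles of each agent use up at least six of the eight goods, so all
  contested bundles are small, which is possible for at most one agent.\<close>

lemma three_agents_eight_goods:
  assumes "finite S" "card S \<le> 8" "i \<noteq> j" "i \<noteq> k" "j \<noteq> k"
    and "\<And>l. l \<in> {i, j, k} \<Longrightarrow> splits (v l) (t l) 3 S"
  shows "allocatable v t {i, j, k} S"
proof (rule ccontr)
  assume "\<not> ?thesis"
  then have st: "stuck S i j k" using assms by (auto simp: stuck_def)
  obtain X Y Z where X: "lab S i j k X Y Z" using stuck_lab[OF st] .
  obtain X' Y' Z' where X': "lab S j i k X' Y' Z'" using stuck_lab[OF stuck_perm(2)[OF st]] .
  have "card X \<le> 2" "card X' \<le> 2"
    using lab_card[OF st X] lab_card[OF stuck_perm(2)[OF st] X'] X X' assms(1,2)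
      part3_card[of i S X Y Z] part3_card[of j S X' Y' Z'] by (auto simp: lab_def)
  then show False using stuck_small_unique[OF st X X'] by simp
qed

end

subsection \<open>Three orthogonal partitions into triples\<close>

text \<open>The letters \<open>a\<close>, \<open>b\<close>, \<open>d\<close> are the rows of a 3x3 grid.  The strict inequalities say that
  columns 1 and 2 and two broken diagonals are worth less than \<open>c\<close>; each disjunction says that
  the six cells off one of these four lines cannot be split into two acceptable halves.\<close>

lemma grid_arith:
  fixes c :: real
  assumes "a0 + a1 + a2 \<ge> c" "b0 + b1 + b2 \<ge> c" "d0 + d1 + d2 \<ge> c"
    and "a1 + b1 + d1 < c" "a2 + b2 + d2 < c" "a1 + b2 + d0 < c" "a2 + b0 + d1 < c"
    and "a0 + b0 + a2 < c \<or> b1 + d1 + d2 < c"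
    and "a0 + a1 + b1 < c \<or> d0 + b2 + d2 < c"
    and "a0 + d0 + a1 < c \<or> b0 + b1 + d1 < c"
    and "a0 + d0 + d2 < c \<or> b0 + a2 + b2 < c"
  shows False
  using assms by linarith

definition orthogonal :: "'g set set \<Rightarrow> 'g set set \<Rightarrow> bool" where
  "orthogonal P Q \<longleftrightarrow> (\<forall>A\<in>P. \<forall>B\<in>Q. card (A \<inter> B) = 1)"

text \<open>An element of \<open>X'\<close> lies in \<open>X\<close>, \<open>Y\<close> or
  \<open>Z\<close>, and disjointness excludes the last two. This upgrades inclusions between grid
  lines to equalities.\<close>

lemma disjoint_three_eq:
  assumes "X \<subseteq> X'" "Y \<subseteq> Y'" "Z \<subseteq> Z'" "X' \<union> Y' \<union> Z' \<subseteq> X \<union> Y \<union> Z"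
    "X' \<inter> Y' = {}" "X' \<inter> Z' = {}" "Y' \<inter> Z' = {}"
  shows "X = X'" "Y = Y'" "Z = Z'"
  using assms by blast+

text \<open>The sets \<open>R\<close> are the rows and the sets \<open>B\<close> the columns;
  orthogonality makes each cell a single good and each \<open>C\<close> a transversal. Once
  \<open>C0\<close> is the main diagonal, \<open>C1\<close> and \<open>C2\<close> are derangements
  of three columns, and only the two 3-cycles exist.\<close>

lemma grid_coordinates:
  assumes "R0 \<union> R1 \<union> R2 = S" "R0 \<inter> R1 = {}" "R0 \<inter> R2 = {}" "R1 \<inter> R2 = {}"
    and "B0 \<union> B1 \<union> B2 = S" "B0 \<inter> B1 = {}" "B0 \<inter> B2 = {}" "B1 \<inter> B2 = {}"
    and "C0 \<union> C1 \<union> C2 = S" "C0 \<inter> C1 = {}" "C0 \<inter> C2 = {}" "C1 \<inter> C2 = {}"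
    and RB: "orthogonal {R0, R1, R2} {B0, B1, B2}" and RC: "orthogonal {R0, R1, R2} {C0, C1, C2}"
    and BC: "orthogonal {B0, B1, B2} {C0, C1, C2}"
    and "R0 \<inter> B0 \<inter> C0 \<noteq> {}" "R1 \<inter> B1 \<inter> C0 \<noteq> {}" "R2 \<inter> B2 \<inter> C0 \<noteq> {}"
  obtains a0 a1 a2 b0 b1 b2 d0 d1 d2 where
    "R0 = {a0, a1, a2}" "R1 = {b0, b1, b2}" "R2 = {d0, d1, d2}"
    "B0 = {a0, b0, d0}" "B1 = {a1, b1, d1}" "B2 = {a2, b2, d2}"
    "{C1, C2} = {{a1, b2, d0}, {a2, b0, d1}}" "distinct [a0, a1, a2, b0, b1, b2, d0, d1, d2]"
proof -
  have ex: "\<exists>x. A \<inter> B = {x}" if "orthogonal P Q" "A \<in> P" "B \<in> Q" for A B :: "'a set" and P Q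
    using that by (auto simp: orthogonal_def card_1_singleton_iff)
  obtain a0 a1 a2 b0 b1 b2 d0 d1 d2 where x:
    "R0 \<inter> B0 = {a0}" "R0 \<inter> B1 = {a1}" "R0 \<inter> B2 = {a2}"
    "R1 \<inter> B0 = {b0}" "R1 \<inter> B1 = {b1}" "R1 \<inter> B2 = {b2}"
    "R2 \<inter> B0 = {d0}" "R2 \<inter> B1 = {d1}" "R2 \<inter> B2 = {d2}"
    using RB[THEN ex] by simp metis
  have R: "R0 = {a0, a1, a2}" "R1 = {b0, b1, b2}" "R2 = {d0, d1, d2}"
  proof -
    have "R = (R \<inter> B0) \<union> (R \<inter> B1) \<union> (R \<inter> B2)" if "R \<in> {R0, R1, R2}" for R
      using that assms(1,5) by blast
    from this[of R0] this[of R1] this[of R2]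
    show "R0 = {a0, a1, a2}" "R1 = {b0, b1, b2}" "R2 = {d0, d1, d2}" by (auto simp: x)
  qed
  have B: "B0 = {a0, b0, d0}" "B1 = {a1, b1, d1}" "B2 = {a2, b2, d2}"
  proof -
    have "B = (R0 \<inter> B) \<union> (R1 \<inter> B) \<union> (R2 \<inter> B)" if "B \<in> {B0, B1, B2}" for B
      using that assms(1,5) by blast
    from this[of B0] this[of B1] this[of B2]
    show "B0 = {a0, b0, d0}" "B1 = {a1, b1, d1}" "B2 = {a2, b2, d2}" by (auto simp: x)
  qed
  have dist: "distinct [a0, a1, a2, b0, b1, b2, d0, d1, d2]"
    using x assms(1-8) by auto
  have diag: "a0 \<in> C0" "b1 \<in> C0" "d2 \<in> C0"
    using assms(16-18) x by auto
  have some: "\<exists>p\<in>D. p \<in> A" if "orthogonal P Q" "A \<in> Q" "D \<in> P" for A D :: "'a set" and P Q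
    using ex[OF that(1,3,2)] by blast
  \<comment> \<open>Off the diagonal, every row and every column offers just two cells to
    \<open>C1\<close> and to \<open>C2\<close>. Each choice in one row propagates to all the
    others.\<close>
  have C: "{a1, b2, d0} \<subseteq> C1 \<and> {a2, b0, d1} \<subseteq> C2 \<or> {a2, b0, d1} \<subseteq> C1 \<and> {a1, b2, d0} \<subseteq> C2"
  proof -
    have "a0 \<notin> C1" "b1 \<notin> C1" "d2 \<notin> C1" "a0 \<notin> C2" "b1 \<notin> C2" "d2 \<notin> C2" using diag assms(9-12) by auto
    moreover have "a1 \<in> C1 \<or> a2 \<in> C1" "b0 \<in> C1 \<or> b2 \<in> C1" "d0 \<in> C1 \<or> d1 \<in> C1"
      "a1 \<in> C2 \<or> a2 \<in> C2" "b0 \<in> C2 \<or> b2 \<in> C2" "d0 \<in> C2 \<or> d1 \<in> C2"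
      using some[OF RC, of C1 R0] some[OF RC, of C1 R1] some[OF RC, of C1 R2]
        some[OF RC, of C2 R0] some[OF RC, of C2 R1] some[OF RC, of C2 R2] calculation R by auto
    moreover have "b0 \<in> C1 \<or> d0 \<in> C1" "a1 \<in> C1 \<or> d1 \<in> C1" "a2 \<in> C1 \<or> b2 \<in> C1"
      "b0 \<in> C2 \<or> d0 \<in> C2" "a1 \<in> C2 \<or> d1 \<in> C2" "a2 \<in> C2 \<or> b2 \<in> C2"
      using some[OF BC, of C1 B0] some[OF BC, of C1 B1] some[OF BC, of C1 B2]
        some[OF BC, of C2 B0] some[OF BC, of C2 B1] some[OF BC, of C2 B2] calculation(1-6) B by auto
    moreover have "C1 \<inter> C2 = {}" using assms(12) by auto
    ultimately show ?thesis by blast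
  qed
  have S: "S = {a0, a1, a2, b0, b1, b2, d0, d1, d2}"
    using R assms(1) by auto
  have eq: "C = {a1, b2, d0} \<and> C' = {a2, b0, d1}"
    if "{a1, b2, d0} \<subseteq> C" "{a2, b0, d1} \<subseteq> C'" "C0 \<union> C \<union> C' = S" "C0 \<inter> C = {}" "C0 \<inter> C' = {}"
      "C \<inter> C' = {}" for C C'
  proof -
    have *: "{a0, b1, d2} \<subseteq> C0" "C0 \<union> C \<union> C' \<subseteq> {a0, b1, d2} \<union> {a1, b2, d0} \<union> {a2, b0, d1}"
      using diag that(3) S by auto
    show ?thesis
      using disjoint_three_eq(2,3)[OF *(1) that(1,2) *(2) that(4-6)] by simp
  qed
  from C have "{C1, C2} = {{a1, b2, d0}, {a2, b0, d1}}"
  proof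
    assume "{a1, b2, d0} \<subseteq> C1 \<and> {a2, b0, d1} \<subseteq> C2"
    then show ?thesis using eq[of C1 C2] assms(9-12) by simp
  next
    assume *: "{a2, b0, d1} \<subseteq> C1 \<and> {a1, b2, d0} \<subseteq> C2"
    have "C0 \<union> C2 \<union> C1 = S" "C2 \<inter> C1 = {}" using assms(9,12) by auto
    then show ?thesis using eq[of C2 C1] assms(10,11) * by (simp add: insert_commute)
  qed
  then show ?thesis using that R B dist by blast
qed

text \<open>Here \<open>f\<close> is the valuation of the agent owning the rows, and
  \<open>B0\<close>, \<open>C0\<close> are the contested bundles of two other agents. Coordinates
  reduce the situation to nine numbers and \<open>grid_arith\<close>.\<close>

lemma grid_contradiction_aux:
  fixes f :: "'g \<Rightarrow> real"
  assumes R: "R0 \<union> R1 \<union> R2 = S" "R0 \<inter> R1 = {}" "R0 \<inter> R2 = {}" "R1 \<inter> R2 = {}"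
    and B: "B0 \<union> B1 \<union> B2 = S" "B0 \<inter> B1 = {}" "B0 \<inter> B2 = {}" "B1 \<inter> B2 = {}"
    and C: "C0 \<union> C1 \<union> C2 = S" "C0 \<inter> C1 = {}" "C0 \<inter> C2 = {}" "C1 \<inter> C2 = {}"
    and orth: "orthogonal {R0, R1, R2} {B0, B1, B2}" "orthogonal {R0, R1, R2} {C0, C1, C2}"
      "orthogonal {B0, B1, B2} {C0, C1, C2}"
    and diag: "R0 \<inter> B0 \<inter> C0 \<noteq> {}" "R1 \<inter> B1 \<inter> C0 \<noteq> {}" "R2 \<inter> B2 \<inter> C0 \<noteq> {}"
    and rows: "c \<le> sum f R0" "c \<le> sum f R1" "c \<le> sum f R2"
    and low: "\<And>W. W \<in> {B1, B2, C1, C2} \<Longrightarrow> sum f W < c"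
    and unsplit: "\<And>U V W. W \<in> {B1, B2, C1, C2} \<Longrightarrow> U \<union> V \<subseteq> S - W \<Longrightarrow> U \<inter> V = {} \<Longrightarrow>
      sum f U < c \<or> sum f V < c"
  shows False
proof -
  obtain a0 a1 a2 b0 b1 b2 d0 d1 d2 where x:
    "R0 = {a0, a1, a2}" "R1 = {b0, b1, b2}" "R2 = {d0, d1, d2}"
    "B0 = {a0, b0, d0}" "B1 = {a1, b1, d1}" "B2 = {a2, b2, d2}"
    "{C1, C2} = {{a1, b2, d0}, {a2, b0, d1}}" and dist: "distinct [a0, a1, a2, b0, b1, b2, d0, d1, d2]"
    by (rule grid_coordinates[OF R B C orth diag])
  have lines: "{B1, B2, C1, C2} = {{a1, b1, d1}, {a2, b2, d2}, {a1, b2, d0}, {a2, b0, d1}}"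
    using x by (metis insert_commute insert_is_Un Un_insert_left sup_bot_left)
  have S: "S = {a0, a1, a2, b0, b1, b2, d0, d1, d2}" using R x by auto
  \<comment> \<open>For each of the four lines, one particular halving of the six cells off it is
    tested; the half named first always contains \<open>a0\<close>, the common cell of
    \<open>R0\<close>, \<open>B0\<close> and \<open>C0\<close>.\<close>
  have 1: "sum f {a0, b0, a2} < c \<or> sum f {b1, d1, d2} < c"
    using dist by (intro unsplit[of "{a1, b2, d0}"]) (auto simp: lines S)
  have 2: "sum f {a0, a1, b1} < c \<or> sum f {d0, b2, d2} < c"
    using dist by (intro unsplit[of "{a2, b0, d1}"]) (auto simp: lines S)
  have 3: "sum f {a0, d0, a1} < c \<or> sum f {b0, b1, d1} < c"
    using dist by (intro unsplit[of "{a2, b2, d2}"]) (auto simp: lines S)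
  have 4: "sum f {a0, d0, d2} < c \<or> sum f {b0, a2, b2} < c"
    using dist by (intro unsplit[of "{a1, b1, d1}"]) (auto simp: lines S)
  have 5: "sum f {a1, b1, d1} < c" "sum f {a2, b2, d2} < c" "sum f {a1, b2, d0} < c" "sum f {a2, b0, d1} < c"
    by (intro low; simp add: lines)+
  have sum3: "sum f {p, q, r} = f p + f q + f r" if "p \<noteq> q" "p \<noteq> r" "q \<noteq> r" for p q r
    using that by (simp add: add.assoc)
  have sums:
    "sum f {a0, a1, a2} = f a0 + f a1 + f a2" "sum f {b0, b1, b2} = f b0 + f b1 + f b2"
    "sum f {d0, d1, d2} = f d0 + f d1 + f d2" "sum f {a1, b1, d1} = f a1 + f b1 + f d1"
    "sum f {a2, b2, d2} = f a2 + f b2 + f d2" "sum f {a1, b2, d0} = f a1 + f b2 + f d0"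
    "sum f {a2, b0, d1} = f a2 + f b0 + f d1" "sum f {a0, b0, a2} = f a0 + f b0 + f a2"
    "sum f {b1, d1, d2} = f b1 + f d1 + f d2" "sum f {a0, a1, b1} = f a0 + f a1 + f b1"
    "sum f {d0, b2, d2} = f d0 + f b2 + f d2" "sum f {a0, d0, a1} = f a0 + f d0 + f a1"
    "sum f {b0, b1, d1} = f b0 + f b1 + f d1" "sum f {a0, d0, d2} = f a0 + f d0 + f d2"
    "sum f {b0, a2, b2} = f b0 + f a2 + f b2"
    by (rule sum3; use dist in auto)+
  show False
    by (rule grid_arith[of c "f a0" "f a1" "f a2" "f b0" "f b1" "f b2" "f d0" "f d1" "f d2"])
      (use rows 1 2 3 4 5 in \<open>simp_all only: x(1-3) sums\<close>)
qed

text \<open>The hypotheses are symmetric in the rows. The three cells of \<open>C0\<close> lie in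
  different rows, so the rows can be renumbered to make \<open>C0\<close> the main diagonal; the six
  orders are the six cases.\<close>

lemma grid_contradiction:
  fixes f :: "'g \<Rightarrow> real"
  assumes R: "R0 \<union> R1 \<union> R2 = S" "R0 \<inter> R1 = {}" "R0 \<inter> R2 = {}" "R1 \<inter> R2 = {}"
    and B: "B0 \<union> B1 \<union> B2 = S" "B0 \<inter> B1 = {}" "B0 \<inter> B2 = {}" "B1 \<inter> B2 = {}"
    and C: "C0 \<union> C1 \<union> C2 = S" "C0 \<inter> C1 = {}" "C0 \<inter> C2 = {}" "C1 \<inter> C2 = {}"
    and orth: "orthogonal {R0, R1, R2} {B0, B1, B2}" "orthogonal {R0, R1, R2} {C0, C1, C2}"
      "orthogonal {B0, B1, B2} {C0, C1, C2}"
    and rows: "c \<le> sum f R0" "c \<le> sum f R1" "c \<le> sum f R2"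
    and low: "\<And>W. W \<in> {B1, B2, C1, C2} \<Longrightarrow> sum f W < c"
    and unsplit: "\<And>U V W. W \<in> {B1, B2, C1, C2} \<Longrightarrow> U \<union> V \<subseteq> S - W \<Longrightarrow> U \<inter> V = {} \<Longrightarrow>
      sum f U < c \<or> sum f V < c"
  shows False
proof -
  have ex: "\<exists>x. A \<inter> D = {x}" if "orthogonal P Q" "A \<in> P" "D \<in> Q" for A D :: "'g set" and P Q
    using that by (auto simp: orthogonal_def card_1_singleton_iff)
  obtain p q r where p: "B0 \<inter> C0 = {p}" and q: "B1 \<inter> C0 = {q}" and r: "B2 \<inter> C0 = {r}"
    using orth(3)[THEN ex] by simp metis
  have "p \<in> S" "q \<in> S" "r \<in> S" using p q r C(1) by auto
  moreover have "p \<noteq> q" "p \<noteq> r" "q \<noteq> r" using p q r B by blast+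
  moreover have "\<not> (s \<in> D \<and> u \<in> D)" if "D \<in> {R0, R1, R2}" "s \<noteq> u" "s \<in> C0" "u \<in> C0" for D s u
    using ex[OF orth(2) that(1), of C0] that by (metis IntI insertI1 singletonD)
  moreover have "p \<in> C0" "q \<in> C0" "r \<in> C0" using p q r by auto
  ultimately consider
    "p \<in> R0" "q \<in> R1" "r \<in> R2" | "p \<in> R0" "q \<in> R2" "r \<in> R1" | "p \<in> R1" "q \<in> R0" "r \<in> R2"
    | "p \<in> R1" "q \<in> R2" "r \<in> R0" | "p \<in> R2" "q \<in> R0" "r \<in> R1" | "p \<in> R2" "q \<in> R1" "r \<in> R0"
    using R(1) by (metis (no_types, opaque_lifting) Un_iff insertCI)
  then obtain Q0 Q1 Q2 where Q: "p \<in> Q0" "q \<in> Q1" "r \<in> Q2" "{Q0, Q1, Q2} = {R0, R1, R2}"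
    "Q0 \<union> Q1 \<union> Q2 = S" "Q0 \<inter> Q1 = {}" "Q0 \<inter> Q2 = {}" "Q1 \<inter> Q2 = {}"
    "c \<le> sum f Q0" "c \<le> sum f Q1" "c \<le> sum f Q2"
  proof cases
    case 1 then show ?thesis using R rows by (intro that[of R0 R1 R2]) auto
  next
    case 2 then show ?thesis using R rows by (intro that[of R0 R2 R1]) auto
  next
    case 3 then show ?thesis using R rows by (intro that[of R1 R0 R2]) auto
  next
    case 4 then show ?thesis using R rows by (intro that[of R1 R2 R0]) auto
  next
    case 5 then show ?thesis using R rows by (intro that[of R2 R0 R1]) auto
  next
    case 6 then show ?thesis using R rows by (intro that[of R2 R1 R0]) auto
  qed
  show False
  proof (rule grid_contradiction_aux[OF Q(5-8) B C _ _ orth(3) _ _ _ Q(9-11) low unsplit])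
    show "orthogonal {Q0, Q1, Q2} {B0, B1, B2}" "orthogonal {Q0, Q1, Q2} {C0, C1, C2}"
      unfolding Q(4) by (rule orth)+
    show "Q0 \<inter> B0 \<inter> C0 \<noteq> {}" "Q1 \<inter> B1 \<inter> C0 \<noteq> {}" "Q2 \<inter> B2 \<inter> C0 \<noteq> {}"
      using Q(1-3) p q r by blast+
  qed
qed

subsection \<open>Four agents\<close>

context valuations
begin

definition small :: "'g set \<Rightarrow> 'a \<Rightarrow> 'a \<Rightarrow> 'a \<Rightarrow> bool" where
  "small S i j k \<longleftrightarrow> (\<exists>X Y Z. lab S i j k X Y Z \<and> card X \<le> 2)"

lemma small_swap: "small S i j k \<longleftrightarrow> small S i k j"
  unfolding small_def using lab_swap by blast

text \<open>Agent \<open>k\<close> stays and accepts only \<open>X\<close>. In a stuck triple the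
  two others accept the same single bundle, so the newcomer \<open>l\<close> accepts exactly
  \<open>X\<close> too.\<close>

lemma lab_transfer:
  assumes "stuck S i l k" "lab S i j k X Y Z"
  shows "lab S i l k X Y Z"
  using stuck_favours[OF assms(1), of X Y Z] assms(2) by (auto simp: lab_def favours_def)

lemma small_transfer: "stuck S i l k \<Longrightarrow> small S i j k \<Longrightarrow> small S i l k"
  unfolding small_def using lab_transfer by blast

lemma small_unique: "stuck S i j k \<Longrightarrow> small S i j k \<Longrightarrow> \<not> small S j i k"
  unfolding small_def using stuck_small_unique by blast

lemma card_Int_eq_1:
  assumes "card W = 3" "A \<inter> W \<noteq> {}" "B \<inter> W \<noteq> {}" "C \<inter> W \<noteq> {}" "W \<subseteq> A \<union> B \<union> C"
    "A \<inter> B = {}" "A \<inter> C = {}" "B \<inter> C = {}"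
  shows "card (A \<inter> W) = 1" "card (B \<inter> W) = 1" "card (C \<inter> W) = 1"
proof -
  have fin: "finite W" using assms(1) card.infinite by fastforce
  have "W = (A \<inter> W) \<union> (B \<inter> W) \<union> (C \<inter> W)" using assms by blast
  then have "card W = card (A \<inter> W) + card (B \<inter> W) + card (C \<inter> W)"
    using fin assms by (metis (no_types, lifting) card_Un_disjoint finite_Int finite_UnI
        inf_commute inf_left_commute inf_bot_right inf_sup_distrib2 sup_bot.right_neutral)
  moreover have "card (A \<inter> W) > 0" "card (B \<inter> W) > 0" "card (C \<inter> W) > 0"
    using fin assms by (auto simp: card_gt_0_iff)
  ultimately show "card (A \<inter> W) = 1" "card (B \<inter> W) = 1" "card (C \<inter> W) = 1" using assms(1) by linarith+
qed

text \<open>The triples \<open>Y\<close> and \<open>Z\<close> meet all three bundles of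
  \<open>j\<close>, hence each of them in exactly one good. Each bundle of \<open>j\<close> has
  three goods, which leaves exactly one for \<open>X\<close>.\<close>

lemma lab_orthogonal:
  assumes st: "stuck S i j k" and X: "lab S i j k X Y Z" and P: "part3 j S A B C"
    and "card Y = 3" "card Z = 3" "card A = 3" "card B = 3" "card C = 3"
  shows "orthogonal {X, Y, Z} {A, B, C}"
proof -
  have P': "W \<subseteq> A \<union> B \<union> C" "A \<inter> B = {}" "A \<inter> C = {}" "B \<inter> C = {}" if "W \<in> {Y, Z}" for W
    using P X that by (auto simp: part3_def lab_def)
  have YZ: "card (Q \<inter> W) = 1" if "W \<in> {Y, Z}" "Q \<in> {A, B, C}" for W Q
    using card_Int_eq_1[of W A B C, OF _ lab_meets[OF st X P that(1)] P'[OF that(1)]] that assms by auto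
  have "card (Q \<inter> X) = 1" if Q: "Q \<in> {A, B, C}" for Q
  proof -
    have card: "card Q = 3" using Q assms by auto
    then have fin: "finite Q" using card.infinite by fastforce
    have "Q \<subseteq> X \<union> Y \<union> Z" "X \<inter> Y = {}" "X \<inter> Z = {}" "Y \<inter> Z = {}"
      using Q P X by (auto simp: part3_def lab_def)
    then have "Q = (Q \<inter> X) \<union> ((Q \<inter> Y) \<union> (Q \<inter> Z))" "(Q \<inter> X) \<inter> ((Q \<inter> Y) \<union> (Q \<inter> Z)) = {}"
      "(Q \<inter> Y) \<inter> (Q \<inter> Z) = {}" by blast+
    then have "card Q = card (Q \<inter> X) + (card (Q \<inter> Y) + card (Q \<inter> Z))"
      using fin by (metis card_Un_disjoint finite_Int finite_UnI)
    then show ?thesis using YZ[of Y Q] YZ[of Z Q] Q card by simp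
  qed
  then show ?thesis using YZ by (auto simp: orthogonal_def Int_commute)
qed

text \<open>Agent \<open>k\<close> is common to the three stuck triples. If none of
  \<open>i\<close>, \<open>j\<close>, \<open>l\<close> were small, their partitions would form the
  grid, and the valuation of \<open>i\<close> would contradict
  \<open>grid_contradiction\<close>.\<close>

lemma three_stuck_triples:
  assumes "stuck S i j k" "stuck S i l k" "stuck S j l k" "card S \<le> 9"
  shows "small S i j k \<or> small S j l k \<or> small S l i k"
proof (rule ccontr)
  assume not_small: "\<not> ?thesis"
  note st = assms(1-3) assms(1-3)[THEN stuck_perm(2)]
  obtain X Y Z where i: "lab S i j k X Y Z" using stuck_lab[OF st(1)] .
  obtain X' Y' Z' where j: "lab S j l k X' Y' Z'" using stuck_lab[OF st(3)] .
  obtain X'' Y'' Z'' where l: "lab S l i k X'' Y'' Z''" using stuck_lab[OF st(5)] .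
  have i': "lab S i l k X Y Z" and j': "lab S j i k X' Y' Z'" and l': "lab S l j k X'' Y'' Z''"
    using lab_transfer i j l st by blast+
  have fin: "finite S" using assms by (auto simp: stuck_def)
  have P: "part3 i S X Y Z" "part3 j S X' Y' Z'" "part3 l S X'' Y'' Z''"
    using i j l by (auto simp: lab_def)
  \<comment> \<open>Now all nine bundles have at least three goods, and there are at most nine
    goods, so all are triples.\<close>
  have "card X > 2" "card X' > 2" "card X'' > 2"
    using not_small i j l unfolding small_def by (meson not_le)+
  then have cards: "card X = 3" "card Y = 3" "card Z = 3" "card X' = 3" "card Y' = 3" "card Z' = 3"
    "card X'' = 3" "card Y'' = 3" "card Z'' = 3"
    using lab_card[OF st(1) i] lab_card[OF st(3) j] lab_card[OF st(5) l] assms(4)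
      P[THEN part3_card, OF fin] by linarith+
  have orth: "orthogonal {X, Y, Z} {X', Y', Z'}" "orthogonal {X, Y, Z} {X'', Y'', Z''}"
    "orthogonal {X', Y', Z'} {X'', Y'', Z''}"
    using lab_orthogonal[OF st(1) i P(2)] lab_orthogonal[OF st(2) i' P(3)] lab_orthogonal[OF st(3) j P(3)] cards
    by auto
  have low: "\<not> likes i W" if "W \<in> {Y', Z', Y'', Z''}" for W
    using that j' l by (auto simp: lab_def favours_def)
  \<comment> \<open>The owner of \<open>W\<close>, which is \<open>j\<close> or \<open>l\<close>,
    takes it, and \<open>k\<close> rejects it; so \<open>stuck_not_split\<close> forbids
    \<open>i\<close> to halve the rest.\<close>
  have unsplit: "\<not> likes i U \<or> \<not> likes i V"
    if W: "W \<in> {Y', Z', Y'', Z''}" and UV: "U \<union> V \<subseteq> S - W" "U \<inter> V = {}" for U V W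
  proof (cases "W \<in> {Y', Z'}")
    case True
    then show ?thesis using stuck_not_split[OF st(4), of W U V] j' UV
      by (auto simp: lab_def favours_def part3_def)
  next
    case False
    then show ?thesis using stuck_not_split[OF st(5), of W U V] l W UV
      by (auto simp: lab_def favours_def part3_def)
  qed
  show False
    by (rule grid_contradiction[of X Y Z S X' Y' Z' X'' Y'' Z'' "t i" "v i"])
      (use P orth low unsplit in \<open>simp_all add: part3_def not_le\<close>)
qed

text \<open>The bundle of \<open>g\<close> contains a second good, so the other three bundles have
  at most eight goods, and the two smaller of them at most five. What is left of the bundle of
  \<open>g\<close> joins the largest.\<close>

lemma unlike_single_parts:
  assumes "splits (v k) (t k) 4 S" "finite S" "card S \<le> 10" "g \<in> S" "\<not> likes k {g}"
  obtains A B C where "part3 k (S - {g}) A B C" "card A + card B \<le> 5"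
proof -
  obtain I :: "nat set" and A where I: "finite I" "card I = 4" "disjoint_family_on A I"
    "(\<Union>j\<in>I. A j) = S" "\<forall>j\<in>I. likes k (A j)"
    using splits_full[OF assms(1,2)] by (metis zero_less_numeral)
  obtain a where a: "a \<in> I" "g \<in> A a" using I assms(4) by auto
  then have "likes k (A a)" using I by simp
  then have "A a \<noteq> {g}" using assms(5) by auto
  then obtain x where x: "x \<in> A a" "x \<noteq> g" using a by auto
  have "card (I - {a}) = 3" "finite (I - {a})" using I a by auto
  then obtain d where d: "d \<in> I - {a}" "\<And>j. j \<in> I - {a} \<Longrightarrow> card (A j) \<le> card (A d)"
    using Max_in[of "(\<lambda>j. card (A j)) ` (I - {a})"] Max_ge[of "(\<lambda>j. card (A j)) ` (I - {a})"]
    by (smt (verit, del_insts) card.empty finite_imageI image_iff image_is_empty numeral_eq_Suc nat.distinct(1))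
  have "card (I - {a} - {d}) = 2" using \<open>card (I - {a}) = 3\<close> d(1) by simp
  then obtain b c where bc: "I - {a} - {d} = {b, c}" "b \<noteq> c" by (auto simp: card_2_iff)
  have mem: "b \<in> I" "c \<in> I" "d \<in> I" "b \<noteq> a" "c \<noteq> a" "d \<noteq> a" "b \<noteq> d" "c \<noteq> d" "b \<noteq> c"
    using bc d(1) by auto
  have I_eq: "I = {a, b, c, d}" using bc(1) a d(1) by auto
  have disj: "A p \<inter> A q = {}" if "p \<in> I" "q \<in> I" "p \<noteq> q" for p q
    using I(3) that by (auto simp: disjoint_family_on_def)
  have S: "S = A a \<union> A b \<union> A c \<union> A d" using I(4) I_eq by auto
  have fin: "finite (A b)" "finite (A c)" "finite (A d)" and fin_a: "finite (A a)" using S assms(2) by auto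
  have "card ({g, x} \<union> (A b \<union> (A c \<union> A d))) = 2 + (card (A b) + (card (A c) + card (A d)))"
    using fin disj[of a b] disj[of a c] disj[of a d] disj[of b c] disj[of b d] disj[of c d] mem a x
    by (subst card_Un_disjoint, simp, simp, blast)+ simp
  moreover have "card ({g, x} \<union> (A b \<union> (A c \<union> A d))) \<le> card S"
    using S assms(2) a x by (intro card_mono) auto
  ultimately have "card (A b) + card (A c) \<le> 5"
    using d(2)[of b] d(2)[of c] mem assms(3) by simp
  moreover have "likes k (A d \<union> (A a - {g}))"
    by (rule likes_mono[of k "A d"]) (use I(5) mem(3) fin fin_a in auto)
  moreover have "A b \<union> A c \<union> (A d \<union> (A a - {g})) = S - {g}"
    using disj[of a b] disj[of a c] disj[of a d] mem(1-6) a S by auto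
  moreover have "A b \<inter> A c = {}" "A b \<inter> (A d \<union> (A a - {g})) = {}" "A c \<inter> (A d \<union> (A a - {g})) = {}"
    using disj[of b c] disj[of b d] disj[of b a] disj[of c d] disj[of c a] mem a by auto
  ultimately have "part3 k (S - {g}) (A b) (A c) (A d \<union> (A a - {g}))" "card (A b) + card (A c) \<le> 5"
    using I(5) mem by (simp_all add: part3_def)
  then show ?thesis by (rule that)
qed

text \<open>Two uncontested bundles need six goods, so \<open>A\<close> or \<open>B\<close> is the
  contested one; the other takes three goods and leaves at most two for it.\<close>

lemma part3_small:
  assumes "stuck S k i j" "part3 k S A B C" "card A + card B \<le> 5"
  shows "small S k i j"
proof -
  have P: "part3 k S B A C" "part3 k S C A B" using assms(2) by (auto simp: part3_def)
  consider "lab S k i j A B C" | "lab S k i j B A C" | "lab S k i j C A B"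
    using stuck_favours[OF assms(1,2)] assms(2) P by (auto simp: lab_def)
  then show ?thesis
  proof cases
    case 1
    then have "card A \<le> 2" using lab_card[OF assms(1) 1] assms(3) by simp
    then show ?thesis using 1 small_def by blast
  next
    case 2
    then have "card B \<le> 2" using lab_card[OF assms(1) 2] assms(3) by simp
    then show ?thesis using 2 small_def by blast
  next
    case 3
    then show ?thesis using lab_card[OF assms(1) 3] assms(3) by simp
  qed
qed

lemma four_agents_ten_goods_single:
  assumes "finite S" "card S \<le> 10" and N: "card N = 4" and split: "\<And>l. l \<in> N \<Longrightarrow> splits (v l) (t l) 4 S"
    and "i \<in> N" "g \<in> S" "likes i {g}"
  shows "allocatable v t N S"
proof (rule ccontr)
  assume neg: "\<not> ?thesis"
  define T where "T = S - {g}"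
  have T: "finite T" "card T \<le> 9" using assms by (auto simp: T_def)
  \<comment> \<open>Serving \<open>d\<close> with \<open>g\<close> costs the others one bundle each,
    so a failure of the whole instance leaves them stuck on \<open>T\<close>.\<close>
  have st: "stuck T a b c" if "N = {a, b, c, d}" "distinct [a, b, c, d]" "likes d {g}" for a b c d
  proof -
    have "N - {d} = {a, b, c}" using that by auto
    then have "\<not> allocatable v t {a, b, c} T"
      using allocatable_reduce[of N d S "{g}"] neg that(3) assms(6) by (auto simp: T_def)
    moreover have "splits (v l) (t l) 3 T" if "l \<in> N" for l
      using splits_remove_good[of l "t l" 3 S g] split[OF that] assms(1) by (simp add: T_def)
    ultimately show ?thesis using that(1,2) T(1) by (auto simp: stuck_def)
  qed
  have sm: "small T a b c" if a: "a \<in> N" "\<not> likes a {g}" "stuck T a b c" for a b c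
  proof -
    obtain A B C where "part3 a (S - {g}) A B C" "card A + card B \<le> 5"
      by (rule unlike_single_parts[OF split[OF a(1)] assms(1,2,6) a(2)])
    then show ?thesis using part3_small a(3) by (simp add: T_def)
  qed
  have "card (N - {i}) = 3" using assms by (simp add: card.infinite)
  then obtain a b c where abc: "N - {i} = {a, b, c}" "a \<noteq> b" "a \<noteq> c" "b \<noteq> c" by (auto simp: card_3_iff)
  then have Na: "N = {a, b, c, i}" "distinct [a, b, c, i]" using assms by auto
  have sti: "stuck T a b c" using st[OF Na] assms by simp
  \<comment> \<open>An agent rejecting \<open>g\<close> is small by \<open>sm\<close>, and a stuck
    triple has at most one small agent. So at least two of \<open>a\<close>, \<open>b\<close>,
    \<open>c\<close> accept \<open>g\<close>.\<close>
  have "likes a {g} \<and> likes b {g} \<or> likes a {g} \<and> likes c {g} \<or> likes b {g} \<and> likes c {g}"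
    using small_unique[OF sti] small_unique[OF stuck_perm(1)[OF sti]] small_unique[OF stuck_perm(3)[OF sti]]
      sm stuck_perm[OF sti] sti Na by (metis insertCI)
  then obtain j l k where jl: "likes j {g}" "likes l {g}" "N = {i, j, l, k}" "distinct [i, j, l, k]"
  proof (elim disjE)
    assume "likes a {g} \<and> likes b {g}"
    then show ?thesis using Na by (intro that[of a b c]) auto
  next
    assume "likes a {g} \<and> likes c {g}"
    then show ?thesis using Na by (intro that[of a c b]) auto
  next
    assume "likes b {g} \<and> likes c {g}"
    then show ?thesis using Na by (intro that[of b c a]) auto
  qed
  have s: "stuck T i j k" "stuck T i l k" "stuck T j l k"
    using st[of i j k l] st[of i l k j] st[of j l k i] jl assms by (auto simp: insert_commute)
  note s' = s[THEN stuck_perm(1)] s[THEN stuck_perm(2)] s[THEN stuck_perm(3)] s[THEN stuck_perm(4)] s[THEN stuck_perm(5)] s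
  have one: "small T i j k \<or> small T j l k \<or> small T l i k"
    using three_stuck_triples[OF s T(2)] .
  show False
  proof (cases "likes k {g}")
    case False
    \<comment> \<open>Now \<open>k\<close> is small in every stuck triple, which clashes with the
      small agent that \<open>one\<close> finds among \<open>i\<close>, \<open>j\<close>,
      \<open>l\<close>.\<close>
    then have "small T k p q" if "stuck T k p q" for p q using sm that jl by auto
    then show False using one s' small_unique small_swap by metis
  next
    case True
    then have lk: "likes x {g}" if "x \<in> N" for x using that jl(1-3) assms(7) by auto
    have all: "stuck T p q r" if "distinct [p, q, r]" "{p, q, r} \<subseteq> N" for p q r
    proof -
      have "card (N - {p, q, r}) = 1" using that N by (subst card_Diff_subset) auto
      then obtain d where "N - {p, q, r} = {d}" by (auto simp: card_1_singleton_iff)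
      then have "N = {p, q, r, d}" "distinct [p, q, r, d]" using that by auto
      moreover have "likes d {g}" using lk calculation(1) by auto
      ultimately show ?thesis using st by blast
    qed
    \<comment> \<open>All triples are stuck here, so the other two agents can be replaced one at a
      time: smallness depends on \<open>p\<close> alone.\<close>
    have spread: "small T p q r" if "small T p q' r'" "distinct [p, q, r]" "distinct [p, q', r']"
      "{p, q, r, q', r'} \<subseteq> N" for p q r q' r'
    proof (cases "q = r'")
      case True
      then have "small T p r q" using small_transfer[of T p r q q'] that all[of p r q] by auto
      then show ?thesis using small_swap by blast
    next
      case False
      then have "small T p r' q" using small_transfer[of T p q r' q'] that all[of p q r'] small_swap by auto
      then have "small T p r q" using small_transfer[of T p r q r'] that all[of p r q] by auto
      then show ?thesis using small_swap by blast
    qed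
    have clash: False if "small T p q r" "small T x y p" "distinct [p, q, r]" "distinct [x, y, p]" "{p, q, r, x, y} \<subseteq> N"
      for p q r x y
    proof -
      have "small T p x y" using spread[OF that(1), of x y] that by auto
      moreover have "small T x p y" using that(2) small_swap by blast
      moreover have "stuck T p x y" using all[of p x y] that by auto
      ultimately show False using small_unique by blast
    qed
    \<comment> \<open>With the small agent \<open>p\<close> in the role of the common agent,
      \<open>three_stuck_triples\<close> yields a second small agent among the other three.\<close>
    have no: False if a: "small T p q r" "N = {p, q, r, u}" "distinct [p, q, r, u]" for p q r u
    proof -
      have "small T q r p \<or> small T r u p \<or> small T u q p"
        using a by (intro three_stuck_triples[OF _ _ _ T(2)] all) auto
      then show False
        using clash[OF a(1), of q r] clash[OF a(1), of r u] clash[OF a(1), of u q] a(2,3) by auto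
    qed
    show False using one no[of i j k l] no[of j l k i] no[of l i k j] jl by (auto simp: insert_commute)
  qed
qed

end

subsection \<open>Ordered instances\<close>

lemma sorted_enumeration:
  fixes f :: "'g \<Rightarrow> real"
  assumes "finite S"
  obtains e where "bij_betw e {..<card S} S" "\<And>x y. x \<le> y \<Longrightarrow> y < card S \<Longrightarrow> f (e y) \<le> f (e x)"
proof -
  obtain xs where xs: "set xs = S" "distinct xs" using assms finite_distinct_list by blast
  define ys where "ys = sort_key (\<lambda>g. - f g) xs"
  have ys: "set ys = S" "distinct ys" "length ys = card S"
    using xs by (auto simp: ys_def distinct_card)
  have sorted: "sorted (map (\<lambda>g. - f g) ys)" by (simp add: ys_def)
  have "f (ys ! y) \<le> f (ys ! x)" if "x \<le> y" "y < card S" for x y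
    using sorted_nth_mono[OF sorted that(1)] that ys by simp
  moreover have "bij_betw (nth ys) {..<card S} S"
    using ys by (intro bij_betw_nth) auto
  ultimately show ?thesis by (intro that)
qed

text \<open>Picking sequence: the good of rank \<open>k\<close> in the sorted instance is replaced by the best good
  left when its owner picks in round \<open>k\<close>.  Only \<open>k\<close> goods are gone by then.\<close>

lemma picking_sequence:
  fixes v :: "'a \<Rightarrow> 'g \<Rightarrow> real" and e :: "'a \<Rightarrow> nat \<Rightarrow> 'g"
  assumes "disjoint_family_on B N" and e: "\<And>i. i \<in> N \<Longrightarrow> bij_betw (e i) {..<m} S"
    and mono: "\<And>i x y. i \<in> N \<Longrightarrow> x \<le> y \<Longrightarrow> y < m \<Longrightarrow> v i (e i y) \<le> v i (e i x)"
    and "N \<noteq> {}" "q \<le> m"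
  shows "\<exists>f. inj_on f {..<q} \<and> f ` {..<q} \<subseteq> S \<and> (\<forall>i\<in>N. \<forall>k\<in>B i \<inter> {..<q}. v i (e i k) \<le> v i (f k))"
  using \<open>q \<le> m\<close>
proof (induction q)
  case (Suc q)
  then obtain f where f: "inj_on f {..<q}" "f ` {..<q} \<subseteq> S"
    "\<forall>i\<in>N. \<forall>k\<in>B i \<inter> {..<q}. v i (e i k) \<le> v i (f k)" by auto
  \<comment> \<open>In a round without owner an arbitrary agent picks, so that every round removes
    one good.\<close>
  obtain r where r: "r \<in> N" "\<And>i. i \<in> N \<Longrightarrow> q \<in> B i \<Longrightarrow> i = r"
  proof (cases "\<exists>i\<in>N. q \<in> B i")
    case True
    then obtain r where "r \<in> N" "q \<in> B r" by auto
    then show ?thesis using assms(1) by (intro that[of r]) (auto simp: disjoint_family_on_def)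
  next
    case False
    then show ?thesis using assms(4) that by auto
  qed
  have inj: "inj_on (e r) {..q}"
    using Suc.prems by (intro inj_on_subset[OF bij_betw_imp_inj_on[OF e[OF r(1)]]]) auto
  have "\<not> e r ` {..q} \<subseteq> f ` {..<q}"
  proof
    assume "e r ` {..q} \<subseteq> f ` {..<q}"
    then have "card (e r ` {..q}) \<le> card (f ` {..<q})" by (intro card_mono) auto
    then show False using card_image[OF inj] card_image_le[of "{..<q}" f] by simp
  qed
  then obtain p where p: "p \<le> q" "e r p \<notin> f ` {..<q}" by auto
  define h where "h = f(q := e r p)"
  have "e r p \<in> S" using bij_betwE[OF e[OF r(1)]] p Suc.prems by auto
  moreover have "inj_on h {..<q}" "h ` {..<q} = f ` {..<q}"
    using f(1) by (auto simp: h_def inj_on_def)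
  ultimately have "inj_on h {..<Suc q}" "h ` {..<Suc q} \<subseteq> S"
    using f(2) p(2) unfolding lessThan_Suc inj_on_insert image_insert by (simp_all add: h_def)
  moreover have "v i (e i k) \<le> v i (h k)" if "i \<in> N" "k \<in> B i \<inter> {..<Suc q}" for i k
    using f(3) that r mono[of r p q] p Suc.prems by (cases "k = q") (auto simp: h_def)
  ultimately show ?case by blast
qed simp

text \<open>Reduction to agents who agree on the ranking: \<open>w i k\<close> is the value to
  \<open>i\<close> of her own good of rank \<open>k\<close>. Renaming goods preserves her splits,
  and a picking sequence carries an allocation back.\<close>

lemma sorted_instance:
  fixes v :: "'a \<Rightarrow> 'g \<Rightarrow> real"
  assumes nonneg: "\<And>i g. 0 \<le> v i g" and S: "finite S" and "N \<noteq> {}"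
    and split: "\<And>i. i \<in> N \<Longrightarrow> splits (v i) (t i) n S"
  obtains w :: "'a \<Rightarrow> nat \<Rightarrow> real" where
    "\<forall>i k. 0 \<le> w i k" "\<forall>i x y. x \<le> y \<longrightarrow> w i y \<le> w i x"
    "\<forall>i\<in>N. splits (w i) (t i) n {..<card S}"
    "allocatable w t N {..<card S} \<longrightarrow> allocatable v t N S"
proof -
  define m where "m = card S"
  have "\<exists>e. bij_betw e {..<m} S \<and> (\<forall>x y. x \<le> y \<longrightarrow> y < m \<longrightarrow> v i (e y) \<le> v i (e x))" for i
    using sorted_enumeration[OF S, of "v i"] unfolding m_def by metis
  then obtain e where e: "\<And>i. bij_betw (e i) {..<m} S"
    "\<And>i x y. x \<le> y \<Longrightarrow> y < m \<Longrightarrow> v i (e i y) \<le> v i (e i x)" by metis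
  \<comment> \<open>The value 0 from \<open>m\<close> on keeps \<open>w i\<close> nonnegative and
    decreasing on all natural numbers.\<close>
  define w where "w i k = (if k < m then v i (e i k) else 0)" for i k
  show ?thesis
  proof (rule that[of w]; intro allI ballI impI)
    show "0 \<le> w i k" for i k using nonneg by (simp add: w_def)
    show "w i y \<le> w i x" if "x \<le> y" for i x y
      using e(2)[OF that, of i] that nonneg by (cases "y < m") (simp_all add: w_def)
    show "splits (w i) (t i) n {..<card S}" if i: "i \<in> N" for i
    proof -
      obtain I :: "nat set" and A where I: "finite I" "card I = n" "disjoint_family_on A I"
        "\<forall>j\<in>I. A j \<subseteq> S" "\<forall>j\<in>I. t i \<le> sum (v i) (A j)"
        by (rule splitsE[OF split[OF i]])
      define A' where "A' j = {k. k < m \<and> e i k \<in> A j}" for j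
      have "sum (w i) (A' j) = sum (v i) (A j)" if "j \<in> I" for j
      proof -
        have "bij_betw (e i) (A' j) (A j)"
          using e(1)[of i] I(4) that unfolding bij_betw_def A'_def by (auto intro: inj_on_subset)
        from sum.reindex_bij_betw[OF this, of "v i"]
        have "(\<Sum>k\<in>A' j. v i (e i k)) = sum (v i) (A j)" .
        moreover have "sum (w i) (A' j) = (\<Sum>k\<in>A' j. v i (e i k))"
          by (intro sum.cong) (auto simp: A'_def w_def)
        ultimately show ?thesis by simp
      qed
      then have "splits (w i) (t i) (card I) {..<card S}"
        using I by (intro splitsI[where A=A']) (auto simp: A'_def m_def disjoint_family_on_def)
      then show ?thesis using I by simp
    qed
    assume "allocatable w t N {..<card S}"
    then obtain B where B: "disjoint_family_on B N" "\<And>i. i \<in> N \<Longrightarrow> B i \<subseteq> {..<m} \<and> t i \<le> sum (w i) (B i)"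
      unfolding allocatable_def m_def by blast
    obtain f where f: "inj_on f {..<m}" "f ` {..<m} \<subseteq> S"
      "\<forall>i\<in>N. \<forall>k\<in>B i \<inter> {..<m}. v i (e i k) \<le> v i (f k)"
      using picking_sequence[OF B(1), of e m S v m] e assms(3) by auto
    have "t i \<le> sum (v i) (f ` B i)" if i: "i \<in> N" for i
    proof -
      have "t i \<le> sum (w i) (B i)" using B i by simp
      also have "\<dots> \<le> (\<Sum>k\<in>B i. v i (f k))"
        using B(2)[OF i] f(3) i by (intro sum_mono) (auto simp: w_def)
      also have "\<dots> = sum (v i) (f ` B i)"
        using B(2)[OF i] f(1) by (subst sum.reindex) (auto intro: inj_on_subset)
      finally show ?thesis .
    qed
    moreover have "disjoint_family_on (\<lambda>i. f ` B i) N"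
      using B f(1) unfolding disjoint_family_on_def
      by (metis (no_types, lifting) image_empty inj_on_image_Int)
    moreover have "f ` B i \<subseteq> S" if "i \<in> N" for i using B(2)[OF that] f(2) by blast
    ultimately show "allocatable v t N S" unfolding allocatable_def by blast
  qed
qed

definition exchange :: "nat \<Rightarrow> nat \<Rightarrow> nat \<Rightarrow> nat" where
  "exchange p q = id(p := q, q := p)"

locale sorted_valuations = valuations v t for v :: "'a \<Rightarrow> nat \<Rightarrow> real" and t +
  assumes antimono: "x \<le> y \<Longrightarrow> v i y \<le> v i x"
begin

lemma pair_dominates:
  assumes "x < y" "x \<le> k" "y \<le> s" "k < s"
  shows "sum (v i) {k, s} \<le> sum (v i) {x, y}"
  using assms antimono[of x k i] antimono[of y s i] by simp

text \<open>Only bundle \<open>a\<close> can lose from exchanging its good \<open>p\<close> for the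
  worse good \<open>q\<close>; a bundle that held \<open>q\<close> now holds the better
  \<open>p\<close>.\<close>

lemma swap_bundles:
  assumes I: "disjoint_family_on A I" "\<forall>j\<in>I. A j \<subseteq> S" "\<forall>j\<in>I. j \<noteq> a \<longrightarrow> c \<le> sum (v i) (A j)"
    and "finite S" "a \<in> I" "p \<in> A a" "p \<le> q" "q \<in> S"
  defines "B \<equiv> \<lambda>j. exchange p q ` A j"
  shows "disjoint_family_on B I \<and> (\<forall>j\<in>I. B j \<subseteq> S) \<and> (\<forall>j\<in>I. j \<noteq> a \<longrightarrow> c \<le> sum (v i) (B j))"
proof (intro conjI ballI impI)
  have inj: "inj (exchange p q)" by (auto simp: inj_on_def exchange_def)
  show "disjoint_family_on B I"
    using I(1) inj unfolding B_def disjoint_family_on_def by (metis image_empty image_Int)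
  show "B j \<subseteq> S" if "j \<in> I" for j
    using I(2) that assms(5,6,8) unfolding B_def by (auto simp: exchange_def)
  show "c \<le> sum (v i) (B j)" if j: "j \<in> I" "j \<noteq> a" for j
  proof -
    have "p \<notin> A j" using I(1) j assms(5,6) by (auto simp: disjoint_family_on_def)
    then have "v i g \<le> v i (exchange p q g)" if "g \<in> A j" for g
      using that antimono[OF assms(7)] by (auto simp: exchange_def)
    then have "sum (v i) (A j) \<le> (\<Sum>g\<in>A j. v i (exchange p q g))" by (intro sum_mono)
    also have "\<dots> = sum (v i) (B j)"
      unfolding B_def using inj by (subst sum.reindex) (auto intro: inj_on_subset)
    finally show ?thesis using I(3) j by fastforce
  qed
qed

text \<open>Two exchanges with worse goods bring \<open>s\<close> and \<open>k\<close> into bundle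
  \<open>a\<close>, which is then dropped; the other bundles do not suffer.\<close>

lemma splits_remove_dominated_pair:
  assumes I: "finite I" "disjoint_family_on A (I::nat set)" "\<forall>j\<in>I. A j \<subseteq> S" "\<forall>j\<in>I. c \<le> sum (v i) (A j)"
    and "finite S" "a \<in> I" "x \<in> A a" "y \<in> A a" "x < y" "x \<le> k" "y \<le> s" "k < s" "s \<in> S" "k \<in> S"
  shows "splits (v i) c (card I - 1) (S - {k, s})"
proof -
  \<comment> \<open>\<open>y\<close> has to be exchanged before \<open>x\<close>: if
    \<open>k = y\<close>, exchanging \<open>x\<close> with \<open>k\<close> first would change
    nothing in bundle \<open>a\<close>, and the second exchange would then remove \<open>k\<close>
    from it.\<close>
  define B where "B j = exchange y s ` A j" for j
  have B: "disjoint_family_on B I \<and> (\<forall>j\<in>I. B j \<subseteq> S) \<and> (\<forall>j\<in>I. j \<noteq> a \<longrightarrow> c \<le> sum (v i) (B j))"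
    unfolding B_def using assms by (intro swap_bundles) auto
  have "exchange y s y = s" "exchange y s x = x" using assms by (auto simp: exchange_def)
  then have B_mem: "s \<in> B a" "x \<in> B a" using assms(7,8) unfolding B_def by (metis imageI)+
  define D where "D j = exchange x k ` B j" for j
  have D: "disjoint_family_on D I \<and> (\<forall>j\<in>I. D j \<subseteq> S) \<and> (\<forall>j\<in>I. j \<noteq> a \<longrightarrow> c \<le> sum (v i) (D j))"
    unfolding D_def using assms B B_mem by (intro swap_bundles) auto
  have "exchange x k x = k" "exchange x k s = s" using assms by (auto simp: exchange_def)
  then have D_mem: "s \<in> D a" "k \<in> D a" using B_mem unfolding D_def by (metis imageI)+
  have "splits (v i) c (card (I - {a})) (S - {k, s})"
  proof (rule splitsI[where A=D])
    show "D j \<subseteq> S - {k, s}" if "j \<in> I - {a}" for j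
      using D D_mem that assms(6) unfolding disjoint_family_on_def by blast
  qed (use I D in \<open>auto simp: disjoint_family_on_def\<close>)
  then show ?thesis using I assms(6) by simp
qed

end

subsection \<open>Double counting and the reduction to fewer agents\<close>

context sorted_valuations
begin

text \<open>The hypothesis \<open>reduced\<close> stands for the instance with one agent and two
  goods fewer, so that the cases \<open>n = 4\<close> and \<open>n > 4\<close> can supply it from
  different sources.\<close>

lemma no_single_reduce:
  assumes N: "finite N" "card N = n" "4 \<le> n" and m: "0 < m" "m \<le> n + 6"
    and split: "\<And>i. i \<in> N \<Longrightarrow> splits (v i) (t i) n {..<m}"
    and no_single: "\<And>i g. i \<in> N \<Longrightarrow> g < m \<Longrightarrow> \<not> likes i {g}"
    and reduced: "\<And>i S. i \<in> N \<Longrightarrow> finite S \<Longrightarrow> card S \<le> n + 4 \<Longrightarrow>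
      (\<And>j. j \<in> N - {i} \<Longrightarrow> splits (v j) (t j) (n - 1) S) \<Longrightarrow> allocatable v t (N - {i}) S"
  shows "allocatable v t N {..<m}"
proof (rule ccontr)
  assume neg: "\<not> ?thesis"
  have reduce: False if "k < s" "s < m" "i \<in> N" "likes i {k, s}"
    "\<And>j. j \<in> N - {i} \<Longrightarrow> splits (v j) (t j) (n - 1) ({..<m} - {k, s})" for i k s
  proof -
    have "card ({..<m} - {k, s}) = m - 2" using that by (subst card_Diff_subset) auto
    then have "allocatable v t (N - {i}) ({..<m} - {k, s})"
      using that m by (intro reduced) auto
    then show False using allocatable_reduce[of N i "{..<m}" "{k, s}"] that neg by auto
  qed
  have "\<exists>(I::nat set) A. finite I \<and> card I = n \<and> disjoint_family_on A I \<and> (\<Union>b\<in>I. A b) = {..<m} \<and>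
      (\<forall>b\<in>I. likes j (A b))" if "j \<in> N" for j
    using splits_full[OF split[OF that]] N by (metis finite_lessThan less_le_trans zero_less_numeral)
  then obtain I :: "'a \<Rightarrow> nat set" and A where IA: "\<And>j. j \<in> N \<Longrightarrow> finite (I j) \<and> card (I j) = n \<and>
    disjoint_family_on (A j) (I j) \<and> (\<Union>b\<in>I j. A j b) = {..<m} \<and> (\<forall>b\<in>I j. likes j (A j b))"
    by metis
  have sub: "A j b \<subseteq> {..<m}" if "j \<in> N" "b \<in> I j" for j b using IA that by blast
  then have fin: "finite (A j b)" if "j \<in> N" "b \<in> I j" for j b using that finite_subset by blast
  have card2: "2 \<le> card (A j b)" if jb: "j \<in> N" "b \<in> I j" for j b
  proof (rule ccontr)
    assume "\<not> ?thesis"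
    then have "card (A j b) \<le> Suc 0" by simp
    then obtain g where "g < m" "A j b \<subseteq> {g}"
    proof (cases "A j b = {}")
      case True
      \<comment> \<open>Were the empty bundle acceptable, any good would be; good 0 exists because
        \<open>m\<close> is positive.\<close>
      then show ?thesis using that[of 0] m(1) by simp
    next
      case False
      then obtain g where "g \<in> A j b" by blast
      then show ?thesis
        using that[of g] card_le_Suc0_iff_eq[OF fin[OF jb]] \<open>card (A j b) \<le> Suc 0\<close> sub[OF jb] by auto
    qed
    then have "likes j {g}" using likes_mono[of j "A j b" "{g}"] IA jb by auto
    then show False using no_single \<open>g < m\<close> jb by blast
  qed
  have m_sum: "m = (\<Sum>b\<in>I j. card (A j b))" if "j \<in> N" for j
  proof -
    have "card (\<Union>b\<in>I j. A j b) = (\<Sum>b\<in>I j. card (A j b))"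
      using IA[OF that] fin[OF that] by (intro card_UN_disjoint) (auto simp: disjoint_family_on_def)
    then show ?thesis using IA[OF that] by simp
  qed
  have dominated: "splits (v j) (t j) (n - 1) ({..<m} - {k, s})"
    if "j \<in> N" "b \<in> I j" "x \<in> A j b" "y \<in> A j b" "x < y" "x \<le> k" "y \<le> s" "k < s" "s < m" for j b x y k s
    using splits_remove_dominated_pair[of "I j" "A j" "{..<m}" "t j" j b x y k s] IA[OF that(1)] sub[OF that(1)] that
    by auto
  have nm: "n < m"
  proof -
    obtain j where j: "j \<in> N" using N by fastforce
    have "2 * n \<le> (\<Sum>b\<in>I j. card (A j b))"
      using sum_mono[of "I j" "\<lambda>_. 2" "\<lambda>b. card (A j b)"] card2[OF j] IA[OF j] by simp
    then show ?thesis using m_sum[OF j] N by simp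
  qed
  have not_top: "\<not> likes i {n - 1, n}" if i: "i \<in> N" for i
  proof
    assume likes: "likes i {n - 1, n}"
    have "splits (v j) (t j) (n - 1) ({..<m} - {n - 1, n})" if "j \<in> N - {i}" for j
    proof -
      have j: "j \<in> N" using that by simp
      \<comment> \<open>Pigeonhole: the \<open>n + 1\<close> best goods lie in \<open>n\<close>
        bundles, so some bundle contains two of them. That pair dominates \<open>{n - 1, n}\<close>,
        and its bundle can be given up.\<close>
      have "\<exists>b\<in>I j. g \<in> A j b" if "g \<le> n" for g using IA[OF j] nm that by (auto simp: set_eq_iff)
      then obtain b where b: "\<And>g. g \<le> n \<Longrightarrow> b g \<in> I j \<and> g \<in> A j (b g)" by metis
      have "\<not> inj_on b {..n}"
      proof
        assume "inj_on b {..n}"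
        then have "card {..n} \<le> card (I j)" using b IA[OF j] by (intro card_inj_on_le) auto
        then show False using IA[OF j] by simp
      qed
      then obtain p q where pq: "p \<le> n" "q \<le> n" "p \<noteq> q" "b p = b q" by (auto simp: inj_on_def)
      obtain x y where "x < y" "y \<le> n" "b x = b y"
        using pq that[of p q] that[of q p] by (cases "p < q") auto
      then show ?thesis using dominated[OF j, of "b x" x y "n - 1" n] b[of x] b[of y] N nm by auto
    qed
    then show False using reduce[of "n - 1" n i] likes i N nm by auto
  qed
  \<comment> \<open>The better goods of the two-element bundles of \<open>j\<close>. None has rank
    \<open>n - 1\<close> or more, since \<open>{n - 1, n}\<close> would then be at least as good as
    that bundle.\<close>
  define K where "K j = {k. \<exists>b\<in>I j. \<exists>s. k < s \<and> A j b = {k, s}}" for j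
  have K_sub: "K j \<subseteq> {..<n - 1}" if j: "j \<in> N" for j
  proof
    fix k assume "k \<in> K j"
    then obtain b s where b: "b \<in> I j" "k < s" "A j b = {k, s}" by (auto simp: K_def)
    show "k \<in> {..<n - 1}"
    proof (rule ccontr)
      assume "k \<notin> {..<n - 1}"
      then have "sum (v j) {k, s} \<le> sum (v j) {n - 1, n}"
        using b N by (intro pair_dominates) auto
      moreover have "likes j {k, s}" using IA[OF j] b by metis
      ultimately show False using not_top[OF j] by linarith
    qed
  qed
  \<comment> \<open>There are at least \<open>2n - 6\<close> pairs, and
    \<open>(n - 1) - (2n - 6) = 5 - n\<close>. As a truncated difference this is 1 for
    \<open>n = 4\<close> and 0 for larger \<open>n\<close>.\<close>
  have K_card: "card ({..<n - 1} - K j) \<le> 5 - n" if j: "j \<in> N" for j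
  proof -
    define P where "P = {b \<in> I j. card (A j b) = 2}"
    have P: "finite P" "P \<subseteq> I j" using IA[OF j] by (auto simp: P_def)
    have "3 * n = (\<Sum>b\<in>I j. 3)" using IA[OF j] by simp
    \<comment> \<open>A bundle has at least three goods unless it is a pair, and a pair falls short
      by one.\<close>
    also have "\<dots> \<le> (\<Sum>b\<in>I j. card (A j b) + (if b \<in> P then 1 else 0))"
      using card2[OF j] by (intro sum_mono) (force simp: P_def)
    also have "\<dots> = m + card P"
      using IA[OF j] P m_sum[OF j] by (simp add: sum.distrib sum.If_cases Int_absorb1)
    finally have "3 * n \<le> m + card P" .
    moreover have "card P \<le> card (K j)"
    proof (rule card_inj_on_le)
      have pair: "\<exists>k s. k < s \<and> A j b = {k, s}" if "b \<in> P" for b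
        using that by (auto simp: P_def card_2_iff) (metis insert_commute linorder_neqE_nat)
      show "inj_on (\<lambda>b. Min (A j b)) P"
      proof (rule inj_onI, rule ccontr)
        fix b c assume bc: "b \<in> P" "c \<in> P" "Min (A j b) = Min (A j c)" "b \<noteq> c"
        then have "Min (A j b) \<in> A j b" "Min (A j c) \<in> A j c"
          using fin[OF j] card2[OF j] P by (metis Min_in card.empty not_numeral_le_zero subsetD)+
        moreover have "A j b \<inter> A j c = {}"
          using bc IA[OF j] P(2) unfolding disjoint_family_on_def by blast
        ultimately show False using bc(3) by auto
      qed
      show "(\<lambda>b. Min (A j b)) ` P \<subseteq> K j"
      proof
        fix k assume "k \<in> (\<lambda>b. Min (A j b)) ` P"
        then obtain b where b: "b \<in> P" "k = Min (A j b)" by auto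
        with pair obtain x s where "x < s" "A j b = {x, s}" by blast
        then show "k \<in> K j" using b P by (auto simp: K_def min_def)
      qed
      show "finite (K j)" using K_sub[OF j] finite_subset by blast
    qed
    moreover have "card ({..<n - 1} - K j) = (n - 1) - card (K j)"
      using K_sub[OF j] by (subst card_Diff_subset) (auto intro: finite_subset)
    ultimately show ?thesis using m(2) by linarith
  qed
  \<comment> \<open>Otherwise at least \<open>2 * (n - 1)\<close> incidences would be missing, while
    the agents account for at most \<open>n * (5 - n)\<close>: 6 against 4 for \<open>n = 4\<close>,
    and 0 afterwards.\<close>
  have "\<exists>k<n - 1. card {j \<in> N. k \<notin> K j} \<le> 1"
  proof (rule ccontr)
    assume "\<not> ?thesis"
    then have "2 \<le> card {j \<in> N. k \<notin> K j}" if "k < n - 1" for k using that by force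
    then have "2 * (n - 1) \<le> (\<Sum>k<n - 1. card {j \<in> N. k \<notin> K j})"
      using sum_mono[of "{..<n - 1}" "\<lambda>_. 2" "\<lambda>k. card {j \<in> N. k \<notin> K j}"] by simp
    also have "\<dots> = (\<Sum>k<n - 1. \<Sum>j\<in>{j \<in> N. k \<notin> K j}. 1)" by simp
    also have "\<dots> = (\<Sum>j\<in>N. \<Sum>k | k \<in> {..<n - 1} \<and> k \<notin> K j. 1)"
      using N by (intro sum.swap_restrict) auto
    also have "\<dots> = (\<Sum>j\<in>N. card ({..<n - 1} - K j))" by (simp add: set_diff_eq)
    also have "\<dots> \<le> n * (5 - n)"
      using sum_mono[of N "\<lambda>j. card ({..<n - 1} - K j)" "\<lambda>_. 5 - n"] K_card N by simp
    finally show False using N(3) by (cases "n = 4") auto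
  qed
  then obtain k where k: "k < n - 1" "card {j \<in> N. k \<notin> K j} \<le> 1" by blast
  define J where "J = {j \<in> N. k \<in> K j}"
  have J: "finite J" "J \<subseteq> N" using N by (auto simp: J_def)
  have NJ: "card (N - J) \<le> 1"
    using k(2) by (simp add: J_def set_diff_eq) (metis (mono_tags, lifting) Collect_cong)
  then have "J \<noteq> {}" using N by auto
  have "\<exists>b s. b \<in> I j \<and> k < s \<and> A j b = {k, s}" if "j \<in> J" for j
    using that by (auto simp: J_def K_def)
  then obtain b s where bs: "\<And>j. j \<in> J \<Longrightarrow> b j \<in> I j \<and> k < s j \<and> A j (b j) = {k, s j}" by metis
  \<comment> \<open>Agent \<open>i\<close> has the worst partner of \<open>k\<close>, so the pair of
    every \<open>j\<close> in \<open>J\<close> dominates \<open>{k, s i}\<close> and its bundle can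
    be given up.\<close>
  obtain i where i: "i \<in> J" "\<And>j. j \<in> J \<Longrightarrow> s j \<le> s i"
  proof -
    have "Max (s ` J) \<in> s ` J" using J \<open>J \<noteq> {}\<close> by simp
    then obtain i where "i \<in> J" "s i = Max (s ` J)" by auto
    then show ?thesis using J(1) by (intro that[of i]) auto
  qed
  have iN: "i \<in> N" using i(1) J by blast
  have "likes i (A i (b i))" using IA[OF iN] bs[OF i(1)] by blast
  then have si: "k < s i" "s i < m" "likes i {k, s i}"
    using bs[OF i(1)] sub[OF iN, of "b i"] by auto
  have splitJ: "splits (v j) (t j) (n - 1) ({..<m} - {k, s i})" if "j \<in> J" for j
    using dominated[of j "b j" k "s j" k "s i"] bs[OF that] i(2)[OF that] si that J by auto
  show False
  \<comment> \<open>At most one agent lies outside \<open>J\<close>. If she accepts the pair, she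
    receives it; if not, \<open>i\<close> does, and the outsider loses one bundle by
    \<open>splits_remove_pair\<close>.\<close>
  proof (cases "\<exists>l\<in>N - J. likes l {k, s i}")
    case True
    then obtain l where l: "l \<in> N - J" "likes l {k, s i}" by blast
    have "N - J = {l}" using NJ l(1) N(1) by (auto simp: card_le_Suc0_iff_eq)
    then have "N - {l} \<subseteq> J" by auto
    then show False using reduce[OF si(1,2), of l] l splitJ by blast
  next
    case False
    have "splits (v j) (t j) (n - 1) ({..<m} - {k, s i})" if "j \<in> N - {i}" for j
    proof (cases "j \<in> J")
      case j: False
      then have "sum (v j) {k, s i} \<le> t j" using False that by force
      then show ?thesis using splits_remove_pair[of j "t j" "n - 1" "{..<m}" k "s i"] split[of j] that N by simp
    qed (rule splitJ)
    then show False using reduce[OF si(1,2), of i] si i(1) J by blast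
  qed
qed

end

section \<open>Induction on the number of agents\<close>

lemma allocatable_goods:
  fixes v :: "'a \<Rightarrow> nat \<Rightarrow> real"
  assumes "\<And>i g. 0 \<le> v i g" "finite S" "finite N" "card N = n" "1 \<le> n" "n \<noteq> 3" "card S \<le> n + 6"
    and "\<And>i. i \<in> N \<Longrightarrow> splits (v i) (t i) n S"
  shows "allocatable v t N S"
  using assms
\<comment> \<open>The valuations are generalised because the step passes to the sorted ones; the
  thresholds stay fixed.\<close>
proof (induction n arbitrary: v S N rule: less_induct)
  case (less n)
  interpret valuations v t using less.prems by unfold_locales auto
  consider "S = {}" | "n = 1" | "n = 2" | "S \<noteq> {}" "4 \<le> n" using less.prems by linarith
  then show ?case
  proof cases
    case 1
    \<comment> \<open>Thresholds are arbitrary reals, but a split of the empty set forces them to be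
      nonpositive, so empty bundles suffice.\<close>
    have "t i \<le> 0" if "i \<in> N" for i
      using splits_total[OF less.prems(8)[OF that] less.prems(2)] 1 less.prems(5) by (simp add: mult_le_0_iff)
    then show ?thesis unfolding allocatable_def by (intro exI[of _ "\<lambda>_. {}"]) (auto simp: disjoint_family_on_def)
  next
    case 2
    then obtain i where N: "N = {i}" using less.prems by (auto simp: card_1_singleton_iff)
    then have "likes i S" using splits_total[of i "t i" 1 S] less.prems 2 by simp
    then show ?thesis using allocatable_single N by simp
  next
    case 3
    then obtain i j where N: "N = {i, j}" "i \<noteq> j" using less.prems by (auto simp: card_2_iff)
    then have "2 * t j \<le> sum (v j) S" using splits_total[of j "t j" 2 S] less.prems 3 by simp
    then show ?thesis using allocatable_two[of S i j] N less.prems 3 by simp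
  next
    case 4
    have N0: "N \<noteq> {}" using less.prems by auto
    obtain w :: "'a \<Rightarrow> nat \<Rightarrow> real" where w: "\<forall>i k. 0 \<le> w i k" "\<forall>i x y. x \<le> y \<longrightarrow> w i y \<le> w i x"
      "\<forall>i\<in>N. splits (w i) (t i) n {..<card S}"
      "allocatable w t N {..<card S} \<longrightarrow> allocatable v t N S"
      by (rule sorted_instance[of v S N t n, OF less.prems(1,2) N0 less.prems(8)])
    interpret W: sorted_valuations w t using w by unfold_locales auto
    have m: "0 < card S" using 4 less.prems(2) by auto
    have "allocatable w t N {..<card S}"
    proof (cases "\<exists>i\<in>N. \<exists>g<card S. W.likes i {g}")
      case True
      then obtain i g where i: "i \<in> N" "g < card S" "W.likes i {g}" by blast
      show ?thesis
      \<comment> \<open>Giving \<open>g\<close> away leaves at most \<open>(n - 1) + 6\<close>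
        goods, so the induction hypothesis applies unless \<open>n - 1 = 3\<close>; that case needs
        the grid argument.\<close>
      proof (cases "n = 4")
        case True
        then show ?thesis
          using W.four_agents_ten_goods_single[of "{..<card S}" N i g] i w less.prems by simp
      next
        case False
        have "allocatable w t (N - {i}) ({..<card S} - {g})"
        proof (rule less.IH[of "n - 1"])
          show "splits (w j) (t j) (n - 1) ({..<card S} - {g})" if "j \<in> N - {i}" for j
            using W.splits_remove_good[of j "t j" "n - 1" "{..<card S}" g] w(3) that 4 by simp
        qed (use i w less.prems 4 False in auto)
        then show ?thesis using W.allocatable_reduce[of N i "{..<card S}" "{g}"] i by simp
      qed
    next
      case False
      show ?thesis
      proof (rule W.no_single_reduce[OF less.prems(3,4) 4(2) m less.prems(7)])
        fix i T assume i: "i \<in> N" and T: "finite T" "card T \<le> n + 4"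
          and split: "\<And>j. j \<in> N - {i} \<Longrightarrow> splits (w j) (t j) (n - 1) T"
        show "allocatable w t (N - {i}) T"
        \<comment> \<open>Two goods fewer make the difference at \<open>n = 4\<close>: three agents
          with at most eight goods can always be served.\<close>
        proof (cases "n = 4")
          case True
          then have "card (N - {i}) = 3" using i less.prems by simp
          then obtain a b c where "N - {i} = {a, b, c}" "a \<noteq> b" "a \<noteq> c" "b \<noteq> c" by (auto simp: card_3_iff)
          then show ?thesis using W.three_agents_eight_goods[of T a b c] T split True by simp
        next
          case False
          show ?thesis
            by (rule less.IH[of "n - 1"]) (use i T w split less.prems 4 False in auto)
        qed
      qed (use False w(3) in auto)
    qed
    then show ?thesis using w(4) by blast
  qed
qed

section \<open>From thresholds back to maximin shares\<close>

lemma finite_allocations: "finite {A. is_allocation n m A}"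
proof -
  have "{A. is_allocation n m A} \<subseteq> (\<lambda>f j. if j < n then f j else {}) ` (PiE {..<n} (\<lambda>_. Pow {0..<m}))"
  proof
    fix A assume "A \<in> {A. is_allocation n m A}"
    then have A: "is_allocation n m A" by simp
    then have "A = (\<lambda>j. if j < n then restrict A {..<n} j else {})"
      by (auto simp: is_allocation_def fun_eq_iff)
    moreover have "restrict A {..<n} \<in> PiE {..<n} (\<lambda>_. Pow {0..<m})"
      using A by (auto simp: is_allocation_def)
    ultimately show "A \<in> (\<lambda>f j. if j < n then f j else {}) ` (PiE {..<n} (\<lambda>_. Pow {0..<m}))" by blast
  qed
  then show ?thesis by (rule finite_subset) (intro finite_imageI finite_PiE, auto)
qed

text \<open>There are finitely many allocations, and at least one, which gives everything to agent
  0. So the maximum is attained, and an optimal allocation serves as a split.\<close>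

lemma mms_attained:
  assumes "1 \<le> n"
  obtains A where "is_allocation n m A" "\<And>j. j < n \<Longrightarrow> mms n m v i \<le> bundle_value v i (A j)"
proof -
  let ?M = "\<lambda>A. Min {bundle_value v i (A j) | j. j < n}"
  have "is_allocation n m (\<lambda>j. if j = 0 then {0..<m} else {})"
    using assms by (auto simp: is_allocation_def split: if_splits)
  then have "{?M A | A. is_allocation n m A} \<noteq> {}" by blast
  moreover have "finite {?M A | A. is_allocation n m A}"
    using finite_allocations[of n m] by simp
  ultimately have "mms n m v i \<in> {?M A | A. is_allocation n m A}"
    unfolding mms_def by (rule Max_in[rotated])
  then obtain A where A: "is_allocation n m A" "mms n m v i = ?M A" by blast
  have "?M A \<le> bundle_value v i (A j)" if "j < n" for j using that by (intro Min_le) auto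
  then show ?thesis using that A by simp
qed

theorem theorem2:
  fixes n m :: nat and v :: "nat \<Rightarrow> nat \<Rightarrow> real"
  assumes "n \<ge> 1" and "n \<noteq> 3" and "m \<le> n + 6"
    and "\<And>i g. i < n \<Longrightarrow> g < m \<Longrightarrow> v i g \<ge> 0"
  shows "\<exists>A. is_MMS_allocation n m v A"
proof -
  \<comment> \<open>Nonnegativity is only assumed for actual agents and goods; setting all other
    values to 0 makes it hold everywhere.\<close>
  define u where "u i g = (if i < n \<and> g < m then v i g else 0)" for i g
  have u: "sum (u i) B = bundle_value v i B" if "i < n" "B \<subseteq> {0..<m}" for i B
    unfolding bundle_value_def using that by (intro sum.cong) (auto simp: u_def)
  have "splits (u i) (mms n m v i) n {0..<m}" if i: "i < n" for i
  proof -
    obtain A where A: "is_allocation n m A" "\<And>j. j < n \<Longrightarrow> mms n m v i \<le> bundle_value v i (A j)"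
      using mms_attained[OF assms(1)] by blast
    then have sub: "A j \<subseteq> {0..<m}" if "j < n" for j using that by (auto simp: is_allocation_def)
    have "splits (u i) (mms n m v i) (card {..<n}) {0..<m}"
      using A sub u[OF i sub] by (intro splitsI[where A=A]) (auto simp: is_allocation_def disjoint_family_on_def)
    then show ?thesis by simp
  qed
  then have "allocatable u (mms n m v) {..<n} {0..<m}"
    using assms by (intro allocatable_goods[where n=n]) (auto simp: u_def)
  then obtain B where B: "disjoint_family_on B {..<n}"
    "\<And>i. i < n \<Longrightarrow> B i \<subseteq> {0..<m} \<and> mms n m v i \<le> sum (u i) (B i)"
    unfolding allocatable_def by blast
  \<comment> \<open>The bundles \<open>B\<close> may leave goods over; agent 0 receives them, so
    that the union is all of \<open>{0..<m}\<close>.\<close>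
  define A where "A j = (if j = 0 then B 0 \<union> ({0..<m} - (\<Union>i<n. B i)) else if j < n then B j else {})" for j
  have alloc: "is_allocation n m A"
    unfolding is_allocation_def
  proof (intro conjI)
    show "\<forall>j\<ge>n. A j = {}" using assms(1) by (simp add: A_def)
    show "\<forall>j<n. \<forall>k<n. j \<noteq> k \<longrightarrow> A j \<inter> A k = {}"
    proof (intro allI impI)
      fix j k assume "j < n" "k < n" "j \<noteq> k"
      moreover from this have "B j \<inter> B k = {}" using B(1) by (auto simp: disjoint_family_on_def)
      ultimately show "A j \<inter> A k = {}" by (cases "j = 0"; cases "k = 0") (auto simp: A_def)
    qed
    show "(\<Union>j<n. A j) = {0..<m}"
    proof
      show "(\<Union>j<n. A j) \<subseteq> {0..<m}" using B(2) assms(1) by (auto simp: A_def split: if_splits)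
      show "{0..<m} \<subseteq> (\<Union>j<n. A j)"
      proof
        fix g assume g: "g \<in> {0..<m}"
        show "g \<in> (\<Union>j<n. A j)"
        proof (cases "\<exists>j<n. g \<in> B j")
          case True
          then obtain j where "j < n" "g \<in> B j" by blast
          then show ?thesis by (intro UN_I[of j]) (auto simp: A_def)
        next
          case False
          then show ?thesis using g assms(1) by (intro UN_I[of 0]) (auto simp: A_def)
        qed
      qed
    qed
  qed
  have "mms n m v i \<le> bundle_value v i (A i)" if i: "i < n" for i
  proof -
    have sub: "A i \<subseteq> {0..<m}" "B i \<subseteq> A i" using alloc i by (auto simp: is_allocation_def A_def)
    have "sum (u i) (B i) \<le> sum (u i) (A i)"
      using sub assms(4) by (intro sum_mono2) (auto simp: u_def intro: finite_subset)
    then show ?thesis using B(2)[OF i] u[OF i sub(1)] by simp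
  qed
  then show ?thesis using alloc unfolding is_MMS_allocation_def by blast
qed

end
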